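(* Let $H$ satisfy the embedding conditions below with constant $C_H$ and with $h$ a strictly positive probability density w.r.t. $\mu$, and let $f\in H$. Let $0<\alpha<1$, $w=\alpha w_m+(1-\alpha)h$, $\nu=w\mu$, and $(x_1,\dots,x_n)\sim\nu^{\otimes n}$, using weighted least squares with weight $w$. Let $0<\delta<1$, $0<\eta<1$ and $n\ge c_\delta^{-1}\alpha^{-1}m\log(m\eta^{-1})$. Then $S_\delta=\{\lambda_{\min}(\mathbf G^w)\ge1-\delta\}$ satisfies $\mathbb P(S_\delta)\ge1-\eta$, and with probability at least $1-\eta$, $$\|f-\hat P_{V_m}f\|\le\big(C_H+(1-\delta)^{-1/2}(1-\alpha)^{-1/2}\big)\inf_{g\in V_m}\|f-g\|_H$$ (convention $\|v\|_H=+\infty$ for $v\notin H$).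
   Context: $\mathcal X$ is a Polish space with Borel probability measure $\mu$; $\|\cdot\|$ is the $L^2_\mu$ norm. $V_m\subset L^2_\mu$ has $L^2_\mu$-orthonormal basis $\varphi_1,\dots,\varphi_m$, $\boldsymbol\varphi=(\varphi_1,\dots,\varphi_m)^T$, $w_m(x)=\frac1m\|\boldsymbol\varphi(x)\|_2^2$. For points $x_i$ and weight $w$: $\|f\|_n^2=\frac1n\sum_iw(x_i)^{-1}f(x_i)^2$, $\mathbf G^w=\frac1n\sum_iw(x_i)^{-1}\boldsymbol\varphi(x_i)\boldsymbol\varphi(x_i)^T$, $\hat P_{V_m}f$ is the unique minimizer over $V_m$ of $\|f-g\|_n$ (when $\mathbf G^w$ is invertible). $c_\delta=\delta+(1-\delta)\log(1-\delta)$. $H$ is a normed vector space of functions on $\mathcal X$ such that for all $f\in H$: $\|f\|\le C_H\|f\|_H$ and $\operatorname{ess\,sup}_xh(x)^{-1/2}|f(x)|\le\|f\|_H$. *)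

theory Defs
  imports "HOL-Probability.Probability" "Jordan_Normal_Form.Char_Poly"
begin

definition L2norm :: "'a measure \<Rightarrow> ('a \<Rightarrow> real) \<Rightarrow> real" where
  "L2norm M f = sqrt (\<integral>x. (f x)^2 \<partial>M)"

definition orthonormal_L2 :: "'a measure \<Rightarrow> nat \<Rightarrow> (nat \<Rightarrow> 'a \<Rightarrow> real) \<Rightarrow> bool" where
  "orthonormal_L2 M m \<phi> \<longleftrightarrow>
     (\<forall>i<m. \<phi> i \<in> borel_measurable M \<and> integrable M (\<lambda>x. (\<phi> i x)^2)) \<and>
     (\<forall>i<m. \<forall>j<m. (\<integral>x. \<phi> i x * \<phi> j x \<partial>M) = (if i = j then 1 else 0))"

definition Vm :: "nat \<Rightarrow> (nat \<Rightarrow> 'a \<Rightarrow> real) \<Rightarrow> ('a \<Rightarrow> real) set" where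
  "Vm m \<phi> = {g. \<exists>c::nat \<Rightarrow> real. g = (\<lambda>x. \<Sum>i<m. c i * \<phi> i x)}"

definition wm :: "nat \<Rightarrow> (nat \<Rightarrow> 'a \<Rightarrow> real) \<Rightarrow> 'a \<Rightarrow> real" where
  "wm m \<phi> x = (1 / real m) * (\<Sum>i<m. (\<phi> i x)^2)"

definition empnorm :: "nat \<Rightarrow> ('a \<Rightarrow> real) \<Rightarrow> (nat \<Rightarrow> 'a) \<Rightarrow> ('a \<Rightarrow> real) \<Rightarrow> real" where
  "empnorm n w xs f = sqrt ((1 / real n) * (\<Sum>k<n. (f (xs k))^2 / w (xs k)))"

definition gram_w :: "nat \<Rightarrow> (nat \<Rightarrow> 'a \<Rightarrow> real) \<Rightarrow> nat \<Rightarrow> ('a \<Rightarrow> real) \<Rightarrow> (nat \<Rightarrow> 'a) \<Rightarrow> real mat" where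
  "gram_w m \<phi> n w xs = mat m m (\<lambda>(i,j). (1 / real n) * (\<Sum>k<n. \<phi> i (xs k) * \<phi> j (xs k) / w (xs k)))"

definition lambda_min :: "real mat \<Rightarrow> real" where
  "lambda_min A = Min {e. eigenvalue A e}"

definition wls_proj :: "nat \<Rightarrow> (nat \<Rightarrow> 'a \<Rightarrow> real) \<Rightarrow> nat \<Rightarrow> ('a \<Rightarrow> real) \<Rightarrow> (nat \<Rightarrow> 'a)
    \<Rightarrow> ('a \<Rightarrow> real) \<Rightarrow> ('a \<Rightarrow> real)" where
  "wls_proj m \<phi> n w xs f =
     (THE g. g \<in> Vm m \<phi> \<and> (\<forall>g'\<in>Vm m \<phi>. empnorm n w xs (\<lambda>x. f x - g x) \<le> empnorm n w xs (\<lambda>x. f x - g' x)))"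

definition c_delta :: "real \<Rightarrow> real" where
  "c_delta \<delta> = \<delta> + (1 - \<delta>) * ln (1 - \<delta>)"

definition Hnorm_ext :: "('a \<Rightarrow> real) set \<Rightarrow> (('a \<Rightarrow> real) \<Rightarrow> real) \<Rightarrow> ('a \<Rightarrow> real) \<Rightarrow> ereal" where
  "Hnorm_ext H nH v = (if v \<in> H then ereal (nH v) else \<infinity>)"

definition normed_fun_space :: "('a \<Rightarrow> real) set \<Rightarrow> (('a \<Rightarrow> real) \<Rightarrow> real) \<Rightarrow> bool" where
  "normed_fun_space H nH \<longleftrightarrow>
     (\<lambda>x. 0) \<in> H \<and>
     (\<forall>f\<in>H. \<forall>g\<in>H. (\<lambda>x. f x + g x) \<in> H) \<and>
     (\<forall>f\<in>H. \<forall>c::real. (\<lambda>x. c * f x) \<in> H) \<and>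
     (\<forall>f\<in>H. nH f \<ge> 0 \<and> (nH f = 0 \<longleftrightarrow> f = (\<lambda>x. 0))) \<and>
     (\<forall>f\<in>H. \<forall>c::real. nH (\<lambda>x. c * f x) = \<bar>c\<bar> * nH f) \<and>
     (\<forall>f\<in>H. \<forall>g\<in>H. nH (\<lambda>x. f x + g x) \<le> nH f + nH g)"

end

(* The tail bound for the smallest eigenvalue of the Gram matrix G = sum_l u_l u_l^T uses the trace
   of a large even power of N I - G in place of the usual trace exponential, so neither Lieb's
   theorem nor Golden-Thompson is needed.  Along the segment from A to A - u u^T the trace of the
   q-th power has derivative -q k(t), where k is a moment of u; log-convexity of moments bounds
   k' from below by a multiple of k.  Integrating and averaging over the isotropic u, each new
   sample multiplies the expected trace by an explicit factor.  Markov's inequality with N = q/theta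
   and q -> infinity then gives the matrix Chernoff bound m exp(-c_delta n alpha / m).
   On S_delta the normal equations give Pythagoras in the empirical norm, which bounds the error by
   the H-norm of f - g almost surely for each single g in V_m; a countable minimizing sequence of g's then
   passes this to the infimum. *)

theory Submission
  imports Defs "HOL-Real_Asymp.Real_Asymp"
begin

section \<open>Moments and traces of powers of symmetric matrices\<close>

text \<open>The trace after one more sample, tr (A - u u^T)^q, is a polynomial of high degree in u,
  but only the second moments of u are known, so its mean cannot be computed. It is therefore
  bounded by an expression quadratic in u: the moment k(0) = u^T A^(q-1) u involves a matrix that is
  independent of u, so its mean is exactly tr A^(q-1) / n. The differential inequality for k serves
  to replace k(t) by k(0) e^(-rho t). It requires the quadratic form to stay above a margin d = N -
  n R along the whole segment, where R bounds |u|^2; this is why N exceeds n R. Letting N grow like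
  q / theta makes the margin free: the rate rho = (q - 1) R / d tends to theta R, and the
  accumulated gain tends to (1 - e^(-theta R)) / R, as in the scalar Chernoff bound. The constant R
  = m / (alpha n) comes from w >= alpha w_m, and the optimal theta has e^(-theta R) = 1 - delta,
  which produces c_delta.\<close>

definition dot :: "nat \<Rightarrow> (nat \<Rightarrow> real) \<Rightarrow> (nat \<Rightarrow> real) \<Rightarrow> real" where
  "dot m v w = (\<Sum>i<m. v i * w i)"

definition mv :: "nat \<Rightarrow> (nat \<Rightarrow> nat \<Rightarrow> real) \<Rightarrow> (nat \<Rightarrow> real) \<Rightarrow> nat \<Rightarrow> real" where
  "mv m A v i = (\<Sum>j<m. A i j * v j)"

definition symmetric :: "nat \<Rightarrow> (nat \<Rightarrow> nat \<Rightarrow> real) \<Rightarrow> bool" where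
  "symmetric m A \<longleftrightarrow> (\<forall>i<m. \<forall>j<m. A i j = A j i)"

definition unitv :: "nat \<Rightarrow> nat \<Rightarrow> real" where
  "unitv k i = (if i = k then 1 else 0)"

text \<open>The diagonal is read off iterates of \<open>mv\<close> on unit vectors. Functions
  instead of matrices spare dimension conditions and make every entry an ordinary real function of a
  parameter, ready to be differentiated.\<close>

definition tr_pow :: "nat \<Rightarrow> nat \<Rightarrow> (nat \<Rightarrow> nat \<Rightarrow> real) \<Rightarrow> real" where
  "tr_pow m q A = (\<Sum>i<m. (mv m A ^^ q) (unitv i) i)"

lemma dot_comm: "dot m v w = dot m w v"
  by (simp add: dot_def mult.commute)

lemma dot_self_nonneg: "0 \<le> dot m v v"
  by (simp add: dot_def sum_nonneg)

lemma nonneg_if_dot_self_le: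
  assumes "0 < d" and "d * dot m v v \<le> x"
  shows "0 \<le> x"
  using mult_nonneg_nonneg[OF less_imp_le[OF assms(1)] dot_self_nonneg[of m v]] assms(2) by linarith

lemma dot_add_right: "dot m u (\<lambda>i. v i + w i) = dot m u v + dot m u w"
  by (simp add: dot_def algebra_simps sum.distrib)

lemma dot_scale_right: "dot m u (\<lambda>i. c * v i) = c * dot m u v"
  by (simp add: dot_def algebra_simps sum_distrib_left)

lemma dot_unitv: "k < m \<Longrightarrow> dot m v (unitv k) = v k"
  by (simp add: dot_def unitv_def if_distrib cong: if_cong)

lemma mv_add: "mv m A (\<lambda>i. v i + w i) = (\<lambda>i. mv m A v i + mv m A w i)"
  by (simp add: mv_def fun_eq_iff algebra_simps sum.distrib)

lemma mv_scale: "mv m A (\<lambda>i. c * v i) = (\<lambda>i. c * mv m A v i)"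
  by (simp add: mv_def fun_eq_iff algebra_simps sum_distrib_left)

lemma mv_sum: "mv m A (\<lambda>i. \<Sum>j\<in>J. c j * v j i) = (\<lambda>i. \<Sum>j\<in>J. c j * mv m A (v j) i)"
proof -
  have "(\<Sum>l<m. A i l * (\<Sum>j\<in>J. c j * v j l)) = (\<Sum>l<m. \<Sum>j\<in>J. c j * (A i l * v j l))" for i
    by (simp add: sum_distrib_left mult.left_commute)
  also have "(\<Sum>l<m. \<Sum>j\<in>J. c j * (A i l * v j l)) = (\<Sum>j\<in>J. c j * (\<Sum>l<m. A i l * v j l))" for i
    by (subst sum.swap) (simp add: sum_distrib_left)
  finally have "(\<Sum>l<m. A i l * (\<Sum>j\<in>J. c j * v j l)) = (\<Sum>j\<in>J. c j * (\<Sum>l<m. A i l * v j l))" for i .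
  then show ?thesis by (simp add: mv_def fun_eq_iff)
qed

lemma dot_mv_sym:
  assumes "symmetric m A"
  shows "dot m (mv m A v) w = dot m v (mv m A w)"
proof -
  have "dot m (mv m A v) w = (\<Sum>i<m. \<Sum>j<m. A i j * v j * w i)"
    by (simp add: dot_def mv_def sum_distrib_right)
  also have "\<dots> = (\<Sum>i<m. \<Sum>j<m. A j i * v i * w j)" by (rule sum.swap)
  also have "\<dots> = (\<Sum>i<m. \<Sum>j<m. A i j * v i * w j)"
    using assms by (intro sum.cong) (auto simp: symmetric_def)
  also have "\<dots> = dot m v (mv m A w)"
    by (simp add: dot_def mv_def sum_distrib_left algebra_simps)
  finally show ?thesis .
qed

lemma dot_mv_pow_sym:
  assumes "symmetric m A"
  shows "dot m ((mv m A ^^ k) v) w = dot m v ((mv m A ^^ k) w)"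
proof (induction k arbitrary: w)
  case (Suc k)
  then show ?case by (simp add: dot_mv_sym[OF assms] funpow_swap1[of _ k w])
qed simp

lemma dot_mv_pow_split:
  assumes "symmetric m A"
  shows "dot m ((mv m A ^^ j) v) ((mv m A ^^ k) w) = dot m v ((mv m A ^^ (j + k)) w)"
  by (simp add: dot_mv_pow_sym[OF assms] funpow_add)

section \<open>Cauchy-Schwarz inequalities and log-convex moments\<close>

lemma quadratic_nonneg_imp_discriminant:
  fixes a b c :: real
  assumes q: "\<And>t. 0 \<le> a * t\<^sup>2 + 2 * b * t + c" and nn: "0 \<le> a" "0 \<le> c"
  shows "b\<^sup>2 \<le> a * c"
proof (cases "a = 0")
  case True
  have "b = 0"
  proof (rule ccontr)
    assume "b \<noteq> 0"
    \<comment> \<open>At this \<open>t\<close> the function \<open>2 * b * t + c\<close> takes the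
      value -1.\<close>
    with q[of "- (c + 1) / (2 * b)"] True show False by (simp add: field_simps)
  qed
  with True show ?thesis by simp
next
  case False
  with nn have "0 < a" by simp
  with q[of "- b / a"] show ?thesis by (simp add: field_simps power2_eq_square)
qed

lemma psd_Cauchy_Schwarz:
  assumes sym: "symmetric m A" and psd: "\<And>v. 0 \<le> dot m v (mv m A v)"
  shows "(dot m v (mv m A w))\<^sup>2 \<le> dot m v (mv m A v) * dot m w (mv m A w)"
proof -
  define a b c where "a = dot m w (mv m A w)" and "b = dot m v (mv m A w)" and "c = dot m v (mv m A v)"
  have q: "0 \<le> a * t\<^sup>2 + 2 * b * t + c" for t
  proof -
    let ?x = "\<lambda>i. v i + t * w i"
    have ba: "dot m w (mv m A v) = b"
      unfolding b_def using dot_mv_sym[OF sym, of w v] dot_comm[of m "mv m A w" v] by simp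
    have "dot m ?x (mv m A ?x) = dot m (mv m A ?x) v + t * dot m (mv m A ?x) w"
      by (simp only: dot_comm[of m ?x] dot_add_right dot_scale_right)
    also have "\<dots> = c + t * b + t * (b + t * a)"
      using ba unfolding a_def b_def c_def
      by (simp add: dot_comm[of m "\<lambda>i. mv m A v i + t * mv m A w i"] mv_add mv_scale dot_add_right dot_scale_right)
    finally show ?thesis using psd[of ?x] by (simp add: algebra_simps power2_eq_square)
  qed
  have "b\<^sup>2 \<le> a * c" using q by (rule quadratic_nonneg_imp_discriminant) (simp_all add: a_def c_def psd)
  then show ?thesis by (simp add: a_def b_def c_def mult.commute)
qed

lemma dot_Cauchy_Schwarz: "(dot m v w)\<^sup>2 \<le> dot m v v * dot m w w"
  unfolding dot_def using Cauchy_Schwarz_ineq_sum[of v w "{..<m}"] by (simp add: power2_eq_square)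

text \<open>The moments of a positive semidefinite matrix are log-convex: the even steps are the ordinary
  Cauchy--Schwarz inequality, the odd ones Cauchy--Schwarz for the form of the matrix.\<close>

lemma moment_log_convex:
  assumes sym: "symmetric m A" and psd: "\<And>v. 0 \<le> dot m v (mv m A v)"
  shows "(dot m u ((mv m A ^^ Suc j) u))\<^sup>2 \<le> dot m u ((mv m A ^^ j) u) * dot m u ((mv m A ^^ Suc (Suc j)) u)"
proof -
  show ?thesis
  proof (cases "even j")
    case True
    then obtain i where "j = i + i" by (metis evenE mult_2)
    then show ?thesis
      using dot_Cauchy_Schwarz[of m "(mv m A ^^ i) u" "(mv m A ^^ Suc i) u"]
      by (simp only: dot_mv_pow_split[OF sym]) (simp)
  next
    case False
    then obtain i where j: "j = i + Suc i" by (metis oddE mult_2 add_Suc_right Suc_eq_plus1)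
    have "dot m ((mv m A ^^ k) u) (mv m A ((mv m A ^^ l) u)) = dot m u ((mv m A ^^ (k + Suc l)) u)" for k l
      using dot_mv_pow_split[OF sym, of k u "Suc l" u] by simp
    with psd_Cauchy_Schwarz[OF sym psd, of "(mv m A ^^ i) u" "(mv m A ^^ Suc i) u"] j show ?thesis
      by (simp only:) simp
  qed
qed

text \<open>Even moments are squared norms of A^i u, odd ones are the form of \<open>A\<close> at
  A^i u.\<close>

lemma moment_nonneg:
  assumes sym: "symmetric m A" and psd: "\<And>v. 0 \<le> dot m v (mv m A v)"
  shows "0 \<le> dot m u ((mv m A ^^ j) u)"
proof (cases "even j")
  case True
  then obtain i where "j = i + i" by (metis evenE mult_2)
  then show ?thesis
    using dot_self_nonneg[of m "(mv m A ^^ i) u"] by (simp only: dot_mv_pow_split[OF sym])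
next
  case False
  then obtain i where j: "j = i + Suc i" by (metis oddE mult_2 add_Suc_right Suc_eq_plus1)
  then show ?thesis
    using psd[of "(mv m A ^^ i) u"] dot_mv_pow_split[OF sym, of i u "Suc i" u] by simp
qed

text \<open>The even case is the upper bound at A^i u. The odd case needs |A v|^2 <= N v^T A v,
  which follows without diagonalising: Cauchy-Schwarz for the form of \<open>A\<close> at v and A v,
  then the upper bound at A v, leave one factor |A v|^2 to cancel.\<close>

lemma moment_Suc_le:
  assumes sym: "symmetric m A" and psd: "\<And>v. 0 \<le> dot m v (mv m A v)"
    and ub: "\<And>v. dot m v (mv m A v) \<le> N * dot m v v"
  shows "dot m u ((mv m A ^^ Suc j) u) \<le> N * dot m u ((mv m A ^^ j) u)"
proof (cases "even j")
  case True
  then obtain i where j: "j = i + i" by (metis evenE mult_2)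
  have "dot m ((mv m A ^^ i) u) ((mv m A ^^ Suc i) u) \<le> N * dot m ((mv m A ^^ i) u) ((mv m A ^^ i) u)"
    using ub by simp
  then show ?thesis unfolding dot_mv_pow_split[OF sym] j by simp
next
  case False
  then obtain i where j: "j = i + Suc i" by (metis oddE mult_2 add_Suc_right Suc_eq_plus1)
  define v where "v = (mv m A ^^ i) u"
  define x y where "x = dot m (mv m A v) (mv m A v)" and "y = dot m v (mv m A v)"
  have xy: "x \<le> N * y"
  proof -
    have "dot m v (mv m A (mv m A v)) = x" by (simp add: x_def dot_mv_sym[OF sym])
    then have "x\<^sup>2 \<le> y * dot m (mv m A v) (mv m A (mv m A v))"
      using psd_Cauchy_Schwarz[OF sym psd, of v "mv m A v"] by (simp add: y_def)
    also have "\<dots> \<le> y * (N * x)"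
      unfolding x_def by (rule mult_left_mono[OF ub]) (simp add: y_def psd)
    finally have *: "x * x \<le> (N * y) * x" by (simp add: power2_eq_square mult_ac)
    have x0: "0 \<le> x" unfolding x_def by (rule dot_self_nonneg)
    show ?thesis
    proof (cases "x = 0")
      case True
      have "0 \<le> y" by (simp add: y_def psd)
      \<comment> \<open>The sign of \<open>N\<close> is not assumed; a negative \<open>N\<close>
        leaves no room for a positive \<open>y\<close>, since y <= N |v|^2 <= 0.\<close>
      moreover have "y = 0 \<or> 0 \<le> N"
      proof (rule ccontr)
        assume "\<not> (y = 0 \<or> 0 \<le> N)"
        then have "N < 0" "0 < y" using \<open>0 \<le> y\<close> by auto
        moreover have "y \<le> N * dot m v v" using ub by (simp add: y_def)
        ultimately show False
          using mult_nonpos_nonneg[of N "dot m v v"] dot_self_nonneg[of m v] by simp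
      qed
      ultimately show ?thesis using True by auto
    next
      case False
      with * x0 show ?thesis by simp
    qed
  qed
  have "dot m u ((mv m A ^^ Suc j) u) = x"
    using dot_mv_pow_split[OF sym, of "Suc i" u "Suc i" u] by (simp add: x_def v_def j)
  moreover have "dot m u ((mv m A ^^ j) u) = y"
    using dot_mv_pow_split[OF sym, of i u "Suc i" u] by (simp add: y_def v_def j)
  ultimately show ?thesis using xy by simp
qed

lemma log_convex_ratio:
  fixes a :: "nat \<Rightarrow> real"
  assumes lc: "\<And>j. (a (Suc j))\<^sup>2 \<le> a j * a (Suc (Suc j))" and pos: "\<And>j. 0 < a j"
    and "j \<le> k"
  shows "a (Suc j) / a j \<le> a (Suc k) / a k"
proof (rule lift_Suc_mono_le[where f = "\<lambda>j. a (Suc j) / a j", OF _ \<open>j \<le> k\<close>])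
  fix j show "a (Suc j) / a j \<le> a (Suc (Suc j)) / a (Suc j)"
    using lc[of j] pos[of j] pos[of "Suc j"] by (simp add: field_simps power2_eq_square)
qed

text \<open>Raising \<open>j\<close> by one multiplies the left side by the ratio at
  \<open>j\<close> and the right side by the ratio at \<open>j + k\<close>, which is at least as
  large.\<close>

lemma log_convex_mult_le:
  fixes a :: "nat \<Rightarrow> real"
  assumes lc: "\<And>j. (a (Suc j))\<^sup>2 \<le> a j * a (Suc (Suc j))" and pos: "\<And>j. 0 < a j"
  shows "a j * a k \<le> a 0 * a (j + k)"
proof (induction j)
  case (Suc j)
  have "a (Suc j) * a k = (a (Suc j) / a j) * (a j * a k)" using pos[of j] by simp
  also have "\<dots> \<le> (a (Suc (j + k)) / a (j + k)) * (a 0 * a (j + k))"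
    by (intro mult_mono log_convex_ratio[where a = a, OF lc pos] Suc.IH) (simp_all add: pos less_imp_le)
  also have "\<dots> = a 0 * a (Suc j + k)" using pos[of "j + k"] by simp
  finally show ?case .
qed simp

section \<open>Rank-one downdates and the trace along the segment\<close>

definition downdate :: "(nat \<Rightarrow> nat \<Rightarrow> real) \<Rightarrow> (nat \<Rightarrow> real) \<Rightarrow> real \<Rightarrow> nat \<Rightarrow> nat \<Rightarrow> real" where
  "downdate A u t i j = A i j - t * (u i * u j)"

lemma sym_downdate: "symmetric m A \<Longrightarrow> symmetric m (downdate A u t)"
  by (simp add: symmetric_def downdate_def mult.commute)

lemma mv_downdate: "mv m (downdate A u t) v = (\<lambda>i. mv m A v i - t * dot m u v * u i)"
  by (simp add: fun_eq_iff mv_def downdate_def dot_def algebra_simps sum_subtractf sum_distrib_left)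

lemma dot_mv_downdate:
  "dot m v (mv m (downdate A u t) v) = dot m v (mv m A v) - t * (dot m u v)\<^sup>2"
proof -
  have "dot m v (mv m (downdate A u t) v) = dot m v (mv m A v) - t * dot m u v * dot m v u"
    by (simp add: mv_downdate) (simp add: dot_def algebra_simps sum_subtractf sum_distrib_left)
  then show ?thesis by (simp add: dot_comm[of m v u] power2_eq_square)
qed

text \<open>The product rule for noncommuting factors: each of the \<open>q\<close> factors
  contributes -u u^T in its own place, with \<open>j\<close> factors to its left and
  \<open>q - Suc j\<close> to its right.\<close>

lemma has_derivative_mv_pow_downdate:
  "((\<lambda>t. (mv m (downdate A u t) ^^ q) v i) has_real_derivative
     - (\<Sum>j<q. dot m u ((mv m (downdate A u t) ^^ (q - Suc j)) v) * (mv m (downdate A u t) ^^ j) u i)) (at t)"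
proof (induction q arbitrary: i)
  case (Suc q)
  define T where "T t = mv m (downdate A u t)" for t
  define y where "y t = (T t ^^ q) v" for t
  define y' where "y' = (\<lambda>i. \<Sum>j<q. - dot m u ((T t ^^ (q - Suc j)) v) * (T t ^^ j) u i)"
  have IH: "((\<lambda>t. y t i) has_real_derivative y' i) (at t)" for i
    using Suc[of i] by (simp add: y_def y'_def T_def sum_negf)
  have d1: "((\<lambda>t. mv m A (y t) i) has_real_derivative mv m A y' i) (at t)"
    unfolding mv_def by (auto intro!: derivative_eq_intros IH simp: mult.commute)
  have d2: "((\<lambda>t. dot m u (y t)) has_real_derivative dot m u y') (at t)"
    unfolding dot_def by (auto intro!: derivative_eq_intros IH simp: mult.commute)
  have "((\<lambda>t. mv m A (y t) i - t * dot m u (y t) * u i) has_real_derivative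
      mv m A y' i - (dot m u (y t) + t * dot m u y') * u i) (at t)"
    by (auto intro!: derivative_eq_intros d1 d2 simp: algebra_simps)
  moreover have "(\<lambda>t. mv m A (y t) i - t * dot m u (y t) * u i) = (\<lambda>t. (T t ^^ Suc q) v i)"
    by (simp add: fun_eq_iff T_def y_def mv_downdate)
  moreover have "mv m A y' i - (dot m u (y t) + t * dot m u y') * u i
      = - (\<Sum>j<Suc q. dot m u ((T t ^^ (Suc q - Suc j)) v) * (T t ^^ j) u i)"
  proof -
    have "mv m A y' i - (dot m u (y t) + t * dot m u y') * u i = T t y' i - dot m u (y t) * u i"
      by (simp add: T_def mv_downdate algebra_simps)
    also have "T t y' i = - (\<Sum>j<q. dot m u ((T t ^^ (q - Suc j)) v) * (T t ^^ Suc j) u i)"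
      unfolding y'_def T_def mv_sum by (simp add: sum_negf)
    \<comment> \<open>The term \<open>j = 0\<close> comes from differentiating the outermost factor;
      the inherited terms shift by one because they pass through \<open>T t\<close>.\<close>
    finally show ?thesis
      by (simp add: sum.lessThan_Suc_shift y_def del: sum.lessThan_Suc)
  qed
  ultimately show ?case unfolding T_def[symmetric] by simp
qed simp

lemma has_derivative_dot_pow_downdate:
  assumes "symmetric m A"
  shows "((\<lambda>t. dot m u ((mv m (downdate A u t) ^^ q) u)) has_real_derivative
     - (\<Sum>j<q. dot m u ((mv m (downdate A u t) ^^ (q - Suc j)) u) * dot m u ((mv m (downdate A u t) ^^ j) u))) (at t)"
proof -
  have "((\<lambda>t. dot m u ((mv m (downdate A u t) ^^ q) u)) has_real_derivative
     (\<Sum>i<m. u i * - (\<Sum>j<q. dot m u ((mv m (downdate A u t) ^^ (q - Suc j)) u) * (mv m (downdate A u t) ^^ j) u i))) (at t)"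
    unfolding dot_def[of m u "(_ ^^ q) _"]
    by (intro DERIV_sum DERIV_cmult has_derivative_mv_pow_downdate)
  moreover have "(\<Sum>i<m. u i * - (\<Sum>j<q. c j * w j i)) = - (\<Sum>j<q. c j * dot m u (w j))" for c w
    by (simp add: dot_def sum_distrib_left sum_negf mult.left_commute) (rule sum.swap)
  ultimately show ?thesis by simp
qed

text \<open>This is cyclicity of the trace: once symmetry has moved the powers onto
  \<open>u\<close>, all \<open>q\<close> terms of the product rule equal the moment of order
  \<open>q - 1\<close>. For \<open>q = 0\<close> the truncated exponent is harmless because of the
  factor \<open>real q\<close>.\<close>

lemma has_derivative_tr_pow_downdate:
  assumes "symmetric m A"
  shows "((\<lambda>t. tr_pow m q (downdate A u t)) has_real_derivative
     - real q * dot m u ((mv m (downdate A u t) ^^ (q - 1)) u)) (at t)"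
proof -
  define T where "T = mv m (downdate A u t)"
  have sym: "symmetric m (downdate A u t)" using assms by (rule sym_downdate)
  have "((\<lambda>t. tr_pow m q (downdate A u t)) has_real_derivative
     (\<Sum>i<m. - (\<Sum>j<q. dot m u ((T ^^ (q - Suc j)) (unitv i)) * (T ^^ j) u i))) (at t)"
    unfolding tr_pow_def T_def by (intro DERIV_sum has_derivative_mv_pow_downdate)
  moreover have "(\<Sum>i<m. - (\<Sum>j<q. dot m u ((T ^^ (q - Suc j)) (unitv i)) * (T ^^ j) u i))
      = - (\<Sum>i<m. \<Sum>j<q. (T ^^ (q - Suc j)) u i * (T ^^ j) u i)"
    by (simp add: sum_negf T_def dot_mv_pow_sym[OF sym, symmetric] dot_unitv)
  moreover have "(\<Sum>i<m. \<Sum>j<q. (T ^^ (q - Suc j)) u i * (T ^^ j) u i)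
      = (\<Sum>j<q. dot m ((T ^^ (q - Suc j)) u) ((T ^^ j) u))"
    unfolding dot_def by (rule sum.swap)
  moreover have "\<dots> = (\<Sum>j<q. dot m u ((T ^^ (q - 1)) u))"
    unfolding T_def dot_mv_pow_split[OF sym] by (intro sum.cong) auto
  ultimately show ?thesis by (simp add: T_def)
qed

text \<open>The derivative of the moment of order q - 1 consists of products of two moments whose
  orders sum to q - 2. Log-convexity merges the two into one at the price of
  \<open>dot m u u\<close>, and coercivity buys the missing order, since the ratios of successive
  moments start at or above \<open>d\<close>.\<close>

lemma moment_mult_le:
  assumes sym: "symmetric m A" and d: "0 < d" and lb: "\<And>v. d * dot m v v \<le> dot m v (mv m A v)"
  shows "dot m u ((mv m A ^^ j) u) * dot m u ((mv m A ^^ k) u)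
    \<le> dot m u u / d * dot m u ((mv m A ^^ Suc (j + k)) u)"
proof -
  define a where "a j = dot m u ((mv m A ^^ j) u)" for j
  have psd: "0 \<le> dot m v (mv m A v)" for v
    by (rule nonneg_if_dot_self_le[OF d lb])
  have lc: "(a (Suc j))\<^sup>2 \<le> a j * a (Suc (Suc j))" for j
    unfolding a_def by (rule moment_log_convex[OF sym psd])
  have nn: "0 \<le> a j" for j unfolding a_def by (rule moment_nonneg[OF sym psd])
  have a1: "d * a 0 \<le> a 1" using lb[of u] by (simp add: a_def)
  show ?thesis
  proof (cases "a 0 = 0")
    case True
    \<comment> \<open>Log-convexity carries a zero forward, so in the degenerate case both sides
      vanish and ratios are formed only from positive moments.\<close>
    have "a (Suc j) = 0" for j
    proof (induction j)
      case 0
      show ?case using lc[of 0] True by simp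
    next
      case (Suc j)
      then show ?case using lc[of "Suc j"] by simp
    qed
    then have "a j = 0" for j using True by (cases j) auto
    moreover have "dot m u u = a 0" by (simp add: a_def)
    ultimately show ?thesis unfolding a_def[symmetric] by simp
  next
    case False
    have pos: "0 < a j \<and> 0 < a (Suc j)" for j
    proof (induction j)
      case 0
      have "0 < a 0" using False nn[of 0] by simp
      moreover have "0 < d * a 0" using d \<open>0 < a 0\<close> by simp
      ultimately show ?case using a1 by simp
    next
      case (Suc j)
      then have "0 < (a (Suc j))\<^sup>2" by simp
      with lc[of j] have "0 < a j * a (Suc (Suc j))" by linarith
      with Suc show ?case by (simp add: zero_less_mult_iff)
    qed
    then have pos: "0 < a j" for j by blast
    have "d \<le> a 1 / a 0" using a1 pos[of 0] by (simp add: field_simps)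
    also have "\<dots> \<le> a (Suc (j + k)) / a (j + k)"
      using log_convex_ratio[where a = a and j = 0 and k = "j + k", OF lc pos] by simp
    finally have "a (j + k) \<le> a (Suc (j + k)) / d" using pos[of "j + k"] d by (simp add: field_simps)
    then have "a 0 * a (j + k) \<le> a 0 * (a (Suc (j + k)) / d)" using pos[of 0] by (intro mult_left_mono) auto
    with log_convex_mult_le[where a = a and j = j and k = k, OF lc pos] have "a j * a k \<le> a 0 * (a (Suc (j + k)) / d)" by simp
    then show ?thesis by (simp add: a_def)
  qed
qed

text \<open>A Gronwall argument on [0,1]: the derivative of k has \<open>q - 1\<close> terms, each
  at most \<open>R / d\<close> times k, hence the rate \<open>\<rho>\<close>; integrating
  \<open>exp (- \<rho> * t)\<close> gives \<open>(1 - exp (- \<rho>)) / \<rho>\<close>. The moment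
  that remains is taken with the matrix before the downdate, so it can be averaged over
  \<open>u\<close>.\<close>

lemma tr_pow_downdate_le:
  assumes sym: "symmetric m A" and d: "0 < d"
    and lb: "\<And>v. d * dot m v v \<le> dot m v (mv m (downdate A u 1) v)"
    and R: "dot m u u \<le> R" "0 < R" and q: "2 \<le> q"
  defines "\<rho> \<equiv> real (q - 1) * R / d"
  shows "tr_pow m q (downdate A u 1)
    \<le> tr_pow m q A - real q * ((1 - exp (- \<rho>)) / \<rho>) * dot m u ((mv m A ^^ (q - 1)) u)"
proof -
  define k where "k t = dot m u ((mv m (downdate A u t) ^^ (q - 1)) u)" for t
  define k' where "k' t = - (\<Sum>j<q-1. dot m u ((mv m (downdate A u t) ^^ (q - 1 - Suc j)) u)
     * dot m u ((mv m (downdate A u t) ^^ j) u))" for t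
  have \<rho>: "0 < \<rho>" using d R q by (simp add: \<rho>_def)
  \<comment> \<open>The form decreases in \<open>t\<close>, so coercivity at the endpoint
    \<open>t = 1\<close> covers the whole segment.\<close>
  have lbt: "d * dot m v v \<le> dot m v (mv m (downdate A u t) v)" if "t \<le> 1" for t v
  proof -
    have "t * (dot m u v)\<^sup>2 \<le> 1 * (dot m u v)\<^sup>2" using that by (intro mult_right_mono) auto
    with lb[of v] show ?thesis by (simp add: dot_mv_downdate)
  qed
  have nn: "0 \<le> k t" if "t \<le> 1" for t
    unfolding k_def
  proof (rule moment_nonneg[OF sym_downdate[OF sym]])
    fix v show "0 \<le> dot m v (mv m (downdate A u t) v)"
      by (rule nonneg_if_dot_self_le[OF d lbt[OF that]])
  qed
  have dk: "(k has_real_derivative k' t) (at t)" for t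
    unfolding k_def k'_def by (rule has_derivative_dot_pow_downdate[OF sym])
  have k'_ge: "- \<rho> * k t \<le> k' t" if "t \<le> 1" for t
  proof -
    have "dot m u ((mv m (downdate A u t) ^^ (q - 1 - Suc j)) u) * dot m u ((mv m (downdate A u t) ^^ j) u)
        \<le> R / d * k t" if "j < q - 1" for j
    proof -
      have e: "Suc (q - 1 - Suc j + j) = q - 1" using that by simp
      have "dot m u ((mv m (downdate A u t) ^^ (q - 1 - Suc j)) u) * dot m u ((mv m (downdate A u t) ^^ j) u)
        \<le> dot m u u / d * k t"
        using moment_mult_le[OF sym_downdate[OF sym] d lbt[OF \<open>t \<le> 1\<close>], of u "q - 1 - Suc j" j]
        unfolding k_def e .
      also have "\<dots> \<le> R / d * k t"
        using R d nn[OF \<open>t \<le> 1\<close>] by (intro mult_right_mono divide_right_mono) auto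
      finally show ?thesis .
    qed
    then have "- k' t \<le> (\<Sum>j<q-1. R / d * k t)"
      unfolding k'_def by (simp only: minus_minus) (rule sum_mono, simp)
    then show ?thesis by (simp add: \<rho>_def)
  qed
  have k_ge: "k 0 * exp (- \<rho> * t) \<le> k t" if "0 \<le> t" "t \<le> 1" for t
  proof -
    have "k 0 * exp (\<rho> * 0) \<le> k t * exp (\<rho> * t)"
    proof (rule DERIV_nonneg_imp_nondecreasing[OF \<open>0 \<le> t\<close>])
      fix s assume s: "0 \<le> s" "s \<le> t"
      have "((\<lambda>s. k s * exp (\<rho> * s)) has_real_derivative (k' s + \<rho> * k s) * exp (\<rho> * s)) (at s)"
        by (auto intro!: derivative_eq_intros dk simp: algebra_simps)
      moreover have "0 \<le> (k' s + \<rho> * k s) * exp (\<rho> * s)"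
        using k'_ge[of s] s that by simp
      ultimately show "\<exists>y. ((\<lambda>s. k s * exp (\<rho> * s)) has_real_derivative y) (at s) \<and> 0 \<le> y" by blast
    qed
    then show ?thesis by (simp add: exp_minus field_simps)
  qed
  \<comment> \<open>Adding the integral of the lower bound for \<open>q\<close> times k to the trace
    leaves a nonincreasing function; comparing \<open>F 1\<close> with \<open>F 0\<close> replaces
    integration.\<close>
  define F where "F t = tr_pow m q (downdate A u t) + real q * k 0 * ((1 - exp (- \<rho> * t)) / \<rho>)" for t
  have "F 1 \<le> F 0"
  proof (rule DERIV_nonpos_imp_nonincreasing[where f = F])
    fix t :: real assume t: "0 \<le> t" "t \<le> 1"
    have "((\<lambda>t. tr_pow m q (downdate A u t)) has_real_derivative - real q * k t) (at t)"
      unfolding k_def by (rule has_derivative_tr_pow_downdate[OF sym])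
    moreover have "((\<lambda>t. real q * k 0 * ((1 - exp (- \<rho> * t)) / \<rho>)) has_real_derivative
        real q * k 0 * exp (- \<rho> * t)) (at t)"
      using \<rho> by (auto intro!: derivative_eq_intros)
    ultimately have "(F has_real_derivative - real q * k t + real q * k 0 * exp (- \<rho> * t)) (at t)"
      unfolding F_def by (rule DERIV_add)
    moreover have "- real q * k t + real q * k 0 * exp (- \<rho> * t) \<le> 0"
      using mult_left_mono[OF k_ge[OF t], of "real q"] by (simp add: mult.assoc)
    ultimately show "\<exists>y. (F has_real_derivative y) (at t) \<and> y \<le> 0" by blast
  qed simp
  moreover have "downdate A u 0 = A" by (simp add: fun_eq_iff downdate_def)
  ultimately show ?thesis by (simp add: F_def k_def mult_ac)
qed

section \<open>Even traces dominate powers of eigenvalues\<close>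

lemma tr_pow_even:
  assumes "symmetric m A"
  shows "tr_pow m (2 * p) A = (\<Sum>i<m. dot m ((mv m A ^^ p) (unitv i)) ((mv m A ^^ p) (unitv i)))"
  unfolding tr_pow_def dot_mv_pow_split[OF assms]
  by (simp add: mult_2 dot_comm[of m "unitv _"] dot_unitv)

text \<open>No diagonalisation: expand |A^p v|^2 in coordinates, move A^p onto the unit vectors and
  apply Cauchy-Schwarz to each term. The resulting sum of |A^p e_i|^2 is the even trace, for
  \<open>A\<close> of any signature.\<close>

lemma tr_pow_ge_eigenvalue:
  assumes sym: "symmetric m A" and ev: "\<And>i. i < m \<Longrightarrow> mv m A v i = \<mu> * v i" and v: "0 < dot m v v"
  shows "\<mu> ^ (2 * p) \<le> tr_pow m (2 * p) A"
proof -
  have pw: "i < m \<Longrightarrow> (mv m A ^^ k) v i = \<mu> ^ k * v i" for k i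
  proof (induction k arbitrary: i)
    case (Suc k)
    have "mv m A ((mv m A ^^ k) v) i = mv m A (\<lambda>i. \<mu> ^ k * v i) i"
      unfolding mv_def[of m A "(mv m A ^^ k) v"] mv_def[of m A "\<lambda>i. \<mu> ^ k * v i"]
      by (intro sum.cong) (simp_all add: Suc.IH)
    with ev[OF Suc.prems] show ?case by (simp add: mv_scale)
  qed simp
  have "\<mu> ^ (2 * p) * dot m v v = (\<Sum>i<m. (dot m (unitv i) ((mv m A ^^ p) v))\<^sup>2)"
    by (simp add: dot_comm[of m "unitv _"] dot_unitv pw power_mult_distrib power_mult[symmetric]
        dot_def[of m v] power2_eq_square[symmetric] mult.commute sum_distrib_left)
  also have "\<dots> = (\<Sum>i<m. (dot m ((mv m A ^^ p) (unitv i)) v)\<^sup>2)"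
    by (simp add: dot_mv_pow_sym[OF sym])
  also have "\<dots> \<le> (\<Sum>i<m. dot m ((mv m A ^^ p) (unitv i)) ((mv m A ^^ p) (unitv i)) * dot m v v)"
    by (intro sum_mono dot_Cauchy_Schwarz)
  also have "\<dots> = tr_pow m (2 * p) A * dot m v v"
    by (simp add: tr_pow_even[OF sym] sum_distrib_right)
  finally show ?thesis using v by simp
qed

section \<open>The smallest eigenvalue\<close>

abbreviation mat_of_fun :: "nat \<Rightarrow> (nat \<Rightarrow> nat \<Rightarrow> real) \<Rightarrow> real mat" where
  "mat_of_fun m A \<equiv> mat m m (\<lambda>(i, j). A i j)"

lemma dot_self_pos_iff: "0 < dot m v v \<longleftrightarrow> (\<exists>i<m. v i \<noteq> 0)"
proof -
  have "dot m v v = 0 \<longleftrightarrow> (\<forall>i<m. v i = 0)"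
    unfolding dot_def by (subst sum_nonneg_eq_0_iff) auto
  then show ?thesis using dot_self_nonneg[of m v] by auto
qed

lemma mat_of_fun_mult_vec:
  "mat_of_fun m A *\<^sub>v vec m v = vec m (mv m A v)"
  by (rule eq_vecI) (simp_all add: mv_def scalar_prod_def atLeast0LessThan)

text \<open>Values at indices from \<open>m\<close> on are arbitrary, so
  \<open>0 < dot m v v\<close> stands for a nonzero vector and the equations are demanded only below
  \<open>m\<close>.\<close>

lemma eigenvalue_mat_of_fun:
  "eigenvalue (mat_of_fun m A) e \<longleftrightarrow> (\<exists>v. 0 < dot m v v \<and> (\<forall>i<m. mv m A v i = e * v i))"
proof
  assume "eigenvalue (mat_of_fun m A) e"
  then obtain x where x: "x \<in> carrier_vec m" "x \<noteq> 0\<^sub>v m" "mat_of_fun m A *\<^sub>v x = e \<cdot>\<^sub>v x"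
    by (auto simp: eigenvalue_def eigenvector_def)
  define v where "v = vec_index x"
  have xv: "x = vec m v" using x(1) by (intro eq_vecI) (auto simp: v_def)
  have "vec m (mv m A v) = e \<cdot>\<^sub>v vec m v" using x(3) by (simp add: xv mat_of_fun_mult_vec)
  then have "\<forall>i<m. mv m A v i = e * v i"
    by (metis (no_types, lifting) dim_vec index_smult_vec(1) index_vec)
  moreover have "\<exists>i<m. v i \<noteq> 0" using x(2) by (auto simp: xv)
  ultimately show "\<exists>v. 0 < dot m v v \<and> (\<forall>i<m. mv m A v i = e * v i)"
    using dot_self_pos_iff by blast
next
  assume "\<exists>v. 0 < dot m v v \<and> (\<forall>i<m. mv m A v i = e * v i)"
  then obtain v where v: "0 < dot m v v" "\<And>i. i < m \<Longrightarrow> mv m A v i = e * v i" by auto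
  obtain i where "i < m" "v i \<noteq> 0" using v(1) dot_self_pos_iff by blast
  then have "vec m v \<noteq> 0\<^sub>v m" by (metis index_vec index_zero_vec(1))
  moreover have "mat_of_fun m A *\<^sub>v vec m v = e \<cdot>\<^sub>v vec m v"
    unfolding mat_of_fun_mult_vec using v(2) by (intro eq_vecI) auto
  ultimately show "eigenvalue (mat_of_fun m A) e"
    by (auto simp: eigenvalue_def eigenvector_def intro!: exI[of _ "vec m v"])
qed

text \<open>A trivial kernel means that 0 is not an eigenvalue, hence the determinant is nonzero.
  The second form hands over the inverse as a function, ready for solving linear equations.\<close>

lemma injective_imp_invertible:
  assumes "\<And>v. 0 < dot m v v \<Longrightarrow> \<exists>i<m. mv m A v i \<noteq> 0"
  shows "invertible_mat (mat_of_fun m A)"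
    and "\<exists>B. \<forall>v. \<forall>i<m. mv m A (mv m B v) i = v i"
proof -
  let ?A = "mat_of_fun m A"
  have A: "?A \<in> carrier_mat m m" by simp
  have "\<not> eigenvalue ?A 0"
    using assms by (auto simp: eigenvalue_mat_of_fun)
  moreover have "0 \<cdot>\<^sub>v x = 0\<^sub>v m" if "x \<in> carrier_vec m" for x :: "real vec"
    using that by (intro eq_vecI) auto
  ultimately have "\<nexists>x. x \<in> carrier_vec m \<and> x \<noteq> 0\<^sub>v m \<and> ?A *\<^sub>v x = 0\<^sub>v m"
    by (auto simp: eigenvalue_def eigenvector_def)
  then have "det ?A \<noteq> 0" using det_0_iff_vec_prod_zero_field[OF A] by blast
  \<comment> \<open>The argument \<open>()\<close> fills the extension slot of the ring
    record.\<close>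
  from det_non_zero_imp_unit[OF A this, of "()"]
  obtain B where B: "B \<in> carrier_mat m m" "B * ?A = 1\<^sub>m m" "?A * B = 1\<^sub>m m"
    by (auto simp: Units_def ring_mat_def)
  then show "invertible_mat ?A"
    by (auto simp: invertible_mat_def inverts_mat_def)
  define b where "b i j = B $$ (i, j)" for i j
  have Bb: "B = mat_of_fun m b" using B(1) by (intro eq_matI) (auto simp: b_def)
  have "\<forall>v. \<forall>i<m. mv m A (mv m b v) i = v i"
  proof (intro allI impI)
    fix v i assume "i < m"
    have "vec m (mv m A (mv m b v)) = (?A * B) *\<^sub>v vec m v"
      unfolding Bb by (subst assoc_mult_mat_vec) (auto simp: mat_of_fun_mult_vec)
    also have "\<dots> = vec m v" by (simp add: B(3))
    finally show "mv m A (mv m b v) i = v i" using \<open>i < m\<close> by (metis index_vec)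
  qed
  then show "\<exists>B. \<forall>v. \<forall>i<m. mv m A (mv m B v) i = v i" by blast
qed

text \<open>A crude operator bound; what matters is that some finite constant exists, to bound the
  Rayleigh quotient below and to bound the form of an inverse.\<close>

lemma abs_dot_mv_le:
  "\<bar>dot m v (mv m A v)\<bar> \<le> (\<Sum>i<m. \<Sum>j<m. \<bar>A i j\<bar>) * dot m v v"
proof -
  have vv: "\<bar>v i * v j\<bar> \<le> dot m v v" if "i < m" "j < m" for i j
  proof -
    have le: "v k * v k \<le> dot m v v" if "k < m" for k
      unfolding dot_def using that by (intro member_le_sum) auto
    have "0 \<le> (\<bar>v i\<bar> - \<bar>v j\<bar>)\<^sup>2" by simp
    then have "2 * \<bar>v i * v j\<bar> \<le> v i * v i + v j * v j"
      by (simp add: power2_eq_square algebra_simps abs_mult)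
    with le[OF that(1)] le[OF that(2)] show ?thesis by linarith
  qed
  have "\<bar>dot m v (mv m A v)\<bar> = \<bar>\<Sum>i<m. \<Sum>j<m. A i j * (v i * v j)\<bar>"
    by (simp add: dot_def mv_def sum_distrib_left mult.left_commute)
  also have "\<dots> \<le> (\<Sum>i<m. \<Sum>j<m. \<bar>A i j * (v i * v j)\<bar>)"
    by (intro order_trans[OF sum_abs] sum_mono) (rule order_refl)
  also have "\<dots> \<le> (\<Sum>i<m. \<Sum>j<m. \<bar>A i j\<bar> * dot m v v)"
    using vv by (intro sum_mono) (simp add: abs_mult[of "A i j" for i j] mult_left_mono)
  finally show ?thesis by (simp add: sum_distrib_right)
qed

lemma dot_cong: "(\<And>i. i < m \<Longrightarrow> v i = v' i) \<Longrightarrow> (\<And>i. i < m \<Longrightarrow> w i = w' i) \<Longrightarrow> dot m v w = dot m v' w'"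
  by (simp add: dot_def)

text \<open>If the infimum e of the Rayleigh quotient were not an eigenvalue, A - e I would be invertible,
  and Cauchy--Schwarz for its form would bound that form away from 0 on the unit sphere.\<close>

lemma least_eigenvalue_exists:
  assumes sym: "symmetric m A" and m: "1 \<le> m"
  shows "\<exists>e. eigenvalue (mat_of_fun m A) e \<and> (\<forall>v. e * dot m v v \<le> dot m v (mv m A v))"
proof -
  define L where "L = {dot m v (mv m A v) |v. dot m v v = 1}"
  define e where "e = Inf L"
  define B where "B i j = A i j - (if i = j then e else 0)" for i j
  have "dot m (unitv 0) (unitv 0) = 1" using m by (simp add: dot_unitv) (simp add: unitv_def)
  then have ne: "L \<noteq> {}" by (auto simp: L_def)
  have bdd: "bdd_below L"
  proof (rule bdd_belowI[of _ "- (\<Sum>i<m. \<Sum>j<m. \<bar>A i j\<bar>)"])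
    fix x assume "x \<in> L"
    then obtain v where "x = dot m v (mv m A v)" "dot m v v = 1" by (auto simp: L_def)
    with abs_dot_mv_le[of m v A] show "- (\<Sum>i<m. \<Sum>j<m. \<bar>A i j\<bar>) \<le> x" by simp
  qed
  have lb: "e * dot m v v \<le> dot m v (mv m A v)" for v
  proof (cases "0 < dot m v v")
    case True
    define s where "s = 1 / sqrt (dot m v v)"
    have s: "s * s = 1 / dot m v v" using True by (simp add: s_def)
    have sc: "dot m (\<lambda>i. s * v i) (\<lambda>i. s * w i) = s * s * dot m v w" for w
      by (simp add: dot_def sum_distrib_left mult_ac)
    have "s * s * dot m v (mv m A v) \<in> L"
      unfolding L_def using sc[of v] sc[of "mv m A v"] s True
      by (intro CollectI exI[of _ "\<lambda>i. s * v i"]) (simp add: mv_scale)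
    then have "e \<le> s * s * dot m v (mv m A v)" unfolding e_def by (rule cInf_lower[OF _ bdd])
    then show ?thesis using True by (simp add: s field_simps)
  next
    case False
    then have "dot m v v = 0" using dot_self_nonneg[of m v] by simp
    then show ?thesis using abs_dot_mv_le[of m v A] by simp
  qed
  have mvB: "mv m B v i = mv m A v i - e * v i" if "i < m" for v i
  proof -
    have "(\<Sum>j<m. (if i = j then e else 0) * v j) = e * v i"
      using that by (simp add: if_distrib[of "\<lambda>x. x * _"] cong: if_cong)
    then show ?thesis by (simp add: mv_def B_def left_diff_distrib sum_subtractf)
  qed
  have formB: "dot m v (mv m B v) = dot m v (mv m A v) - e * dot m v v" for v
  proof -
    have "dot m v (mv m B v) = dot m v (\<lambda>i. mv m A v i - e * v i)"
      by (rule dot_cong) (simp_all add: mvB)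
    then show ?thesis by (simp add: dot_def algebra_simps sum_subtractf sum_distrib_left)
  qed
  have symB: "symmetric m B" using sym by (auto simp: symmetric_def B_def)
  have psd: "0 \<le> dot m v (mv m B v)" for v using lb[of v] by (simp add: formB)
  have "eigenvalue (mat_of_fun m A) e"
  proof (rule ccontr)
    assume no: "\<not> eigenvalue (mat_of_fun m A) e"
    have "\<exists>i<m. mv m B v i \<noteq> 0" if v: "0 < dot m v v" for v
    proof -
      obtain i where "i < m" "mv m A v i \<noteq> e * v i" using no v by (auto simp: eigenvalue_mat_of_fun)
      then show ?thesis using mvB by (intro exI[of _ i]) auto
    qed
    from injective_imp_invertible(2)[OF this] obtain C
      where C: "\<And>v i. i < m \<Longrightarrow> mv m B (mv m C v) i = v i" by blast
    \<comment> \<open>Adding 1 keeps \<open>K\<close> positive even if all entries of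
      \<open>C\<close> vanish.\<close>
    define K where "K = (\<Sum>i<m. \<Sum>j<m. \<bar>C i j\<bar>) + 1"
    have K: "0 < K" unfolding K_def by (intro add_nonneg_pos sum_nonneg) auto
    have "e + 1 / K \<le> x" if x: "x \<in> L" for x
    proof -
      obtain v where v: "x = dot m v (mv m A v)" "dot m v v = 1" using x by (auto simp: L_def)
      define w where "w = mv m C v"
      have Bw: "dot m y (mv m B w) = dot m y v" for y
        by (rule dot_cong) (auto simp: w_def C)
      \<comment> \<open>Since B w = v, the mixed term is |v|^2 = 1 and the form at \<open>w\<close>
        is w^T v, which \<open>K\<close> bounds; so the form of \<open>B\<close> is at least 1 / K
        on the unit sphere.\<close>
      have "(dot m v v)\<^sup>2 \<le> dot m v (mv m B v) * dot m w v"
        using psd_Cauchy_Schwarz[OF symB psd, of v w] by (simp add: Bw)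
      also have "\<dots> \<le> dot m v (mv m B v) * K"
        using abs_dot_mv_le[of m v C] psd[of v]
        by (intro mult_left_mono) (auto simp: w_def K_def v dot_comm[of m "mv m C v"])
      finally show ?thesis using K v by (simp add: formB field_simps)
    qed
    then have "e + 1 / K \<le> e" using cInf_greatest[OF ne] unfolding e_def by blast
    then show False using K by simp
  qed
  with lb show ?thesis by blast
qed

text \<open>Finiteness gives \<open>Min\<close> in \<open>lambda_min\<close> its meaning.\<close>

lemma finite_eigenvalues: "finite {e. eigenvalue (mat_of_fun m A) e}"
proof -
  have A: "mat_of_fun m A \<in> carrier_mat m m" by simp
  have "char_poly (mat_of_fun m A) \<noteq> 0" using degree_monic_char_poly[OF A] by auto
  then show ?thesis unfolding eigenvalue_root_char_poly[OF A] by (rule poly_roots_finite)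
qed

text \<open>For symmetric matrices the largest lower bound of the Rayleigh quotient is itself an
  eigenvalue. This turns the event on \<open>lambda_min\<close> into coercivity, which least squares
  uses, and into conditions linear in the entries, which give measurability.\<close>

lemma lambda_min_ge_iff:
  assumes "symmetric m A" and "1 \<le> m"
  shows "c \<le> lambda_min (mat_of_fun m A) \<longleftrightarrow> (\<forall>v. c * dot m v v \<le> dot m v (mv m A v))"
proof -
  obtain e where e: "eigenvalue (mat_of_fun m A) e" "\<And>v. e * dot m v v \<le> dot m v (mv m A v)"
    using least_eigenvalue_exists[OF assms] by blast
  have least: "e \<le> e'" if ev: "eigenvalue (mat_of_fun m A) e'" for e'
  proof -
    obtain v where v: "0 < dot m v v" "\<And>i. i < m \<Longrightarrow> mv m A v i = e' * v i"
      using ev by (auto simp: eigenvalue_mat_of_fun)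
    have "dot m v (mv m A v) = dot m v (\<lambda>i. e' * v i)" by (rule dot_cong) (simp_all add: v)
    with e(2)[of v] v(1) show ?thesis by (simp add: dot_scale_right)
  qed
  have lm: "lambda_min (mat_of_fun m A) = e"
    unfolding lambda_min_def using e(1) least by (intro Min_eqI finite_eigenvalues) auto
  obtain v where v: "0 < dot m v v" "\<And>i. i < m \<Longrightarrow> mv m A v i = e * v i"
    using e(1) by (auto simp: eigenvalue_mat_of_fun)
  have ev: "dot m v (mv m A v) = dot m v (\<lambda>i. e * v i)" by (rule dot_cong) (simp_all add: v)
  show ?thesis unfolding lm
  proof
    assume "c \<le> e"
    show "\<forall>v. c * dot m v v \<le> dot m v (mv m A v)"
    proof
      fix v
      have "c * dot m v v \<le> e * dot m v v" using \<open>c \<le> e\<close> dot_self_nonneg by (intro mult_right_mono)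
      with e(2)[of v] show "c * dot m v v \<le> dot m v (mv m A v)" by simp
    qed
  next
    assume "\<forall>v. c * dot m v v \<le> dot m v (mv m A v)"
    then have "c * dot m v v \<le> dot m v (mv m A v)" ..
    then have "c * dot m v v \<le> e * dot m v v" unfolding ev dot_scale_right .
    with v(1) show "c \<le> e" by simp
  qed
qed

lemma lambda_min_less_imp_eigenvalue:
  assumes "symmetric m A" and "1 \<le> m" and "\<not> c \<le> lambda_min (mat_of_fun m A)"
  shows "\<exists>e<c. eigenvalue (mat_of_fun m A) e"
proof -
  have "lambda_min (mat_of_fun m A) \<in> {e. eigenvalue (mat_of_fun m A) e}"
    unfolding lambda_min_def
    using least_eigenvalue_exists[OF assms(1,2)] by (intro Min_in finite_eigenvalues) auto
  with assms(3) show ?thesis by (intro exI[of _ "lambda_min (mat_of_fun m A)"]) auto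
qed

section \<open>Matrix Chernoff bound for isotropic rank-one summands\<close>

definition shifted_gram :: "real \<Rightarrow> (nat \<Rightarrow> 'b \<Rightarrow> real) \<Rightarrow> nat \<Rightarrow> (nat \<Rightarrow> 'b) \<Rightarrow> nat \<Rightarrow> nat \<Rightarrow> real" where
  "shifted_gram N U k xs i j = (if i = j then N else 0) - (\<Sum>l<k. U i (xs l) * U j (xs l))"

lemma sym_shifted_gram: "symmetric m (shifted_gram N U k xs)"
  by (auto simp: symmetric_def shifted_gram_def mult.commute)

text \<open>Absorbing a sample is a full downdate; the update \<open>xs(k := y)\<close> is the form
  in which the product measure over one more index is split.\<close>

lemma shifted_gram_Suc:
  "shifted_gram N U (Suc k) (xs(k := y)) = downdate (shifted_gram N U k xs) (\<lambda>i. U i y) 1"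
  by (auto simp: fun_eq_iff shifted_gram_def downdate_def)

lemma mv_shifted_gram:
  assumes "i < m"
  shows "mv m (shifted_gram N U k xs) v i = N * v i - (\<Sum>l<k. dot m (\<lambda>i. U i (xs l)) v * U i (xs l))"
proof -
  have "(\<Sum>j<m. (if i = j then N else 0) * v j) = N * v i"
    using assms by (simp add: if_distrib[of "\<lambda>x. x * _"] cong: if_cong)
  moreover have "(\<Sum>j<m. (\<Sum>l<k. U i (xs l) * U j (xs l)) * v j) = (\<Sum>l<k. dot m (\<lambda>i. U i (xs l)) v * U i (xs l))"
    by (simp add: dot_def sum_distrib_right sum_distrib_left mult_ac) (rule sum.swap)
  ultimately show ?thesis by (simp add: mv_def shifted_gram_def left_diff_distrib sum_subtractf)
qed

lemma dot_mv_shifted_gram: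
  "dot m v (mv m (shifted_gram N U k xs) v) = N * dot m v v - (\<Sum>l<k. (dot m (\<lambda>i. U i (xs l)) v)\<^sup>2)"
proof -
  have "dot m v (mv m (shifted_gram N U k xs) v)
      = (\<Sum>i<m. N * (v i * v i)) - (\<Sum>i<m. \<Sum>l<k. dot m (\<lambda>i. U i (xs l)) v * (U i (xs l) * v i))"
    by (simp add: dot_def[of m v "mv _ _ _"] mv_shifted_gram sum_subtractf[symmetric]
        right_diff_distrib sum_distrib_left mult_ac)
  moreover have "(\<Sum>i<m. \<Sum>l<k. dot m (\<lambda>i. U i (xs l)) v * (U i (xs l) * v i))
      = (\<Sum>l<k. (dot m (\<lambda>i. U i (xs l)) v)\<^sup>2)"
    by (subst sum.swap) (simp add: power2_eq_square sum_distrib_left[symmetric] dot_def[symmetric])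
  ultimately show ?thesis by (simp add: dot_def[of m v v] sum_distrib_left)
qed

lemma dot_mv_shifted_gram_le: "dot m v (mv m (shifted_gram N U k xs) v) \<le> N * dot m v v"
  by (simp add: dot_mv_shifted_gram sum_nonneg)

text \<open>Each sample lowers the form by at most R |v|^2, wherever the points lie; this keeps all
  matrices of the induction coercive with margin N - n R.\<close>

lemma dot_mv_shifted_gram_ge:
  assumes "\<And>x. dot m (\<lambda>i. U i x) (\<lambda>i. U i x) \<le> R"
  shows "(N - real k * R) * dot m v v \<le> dot m v (mv m (shifted_gram N U k xs) v)"
proof -
  have "(\<Sum>l<k. (dot m (\<lambda>i. U i (xs l)) v)\<^sup>2) \<le> (\<Sum>l<k. R * dot m v v)"
    by (intro sum_mono order_trans[OF dot_Cauchy_Schwarz] mult_right_mono assms dot_self_nonneg)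
  then show ?thesis by (simp add: dot_mv_shifted_gram algebra_simps)
qed

text \<open>Separates the products \<open>u i * u j\<close>, whose means are known, from the entries
  of a fixed matrix power.\<close>

lemma dot_mv_pow_expand:
  assumes "symmetric m A"
  shows "dot m u ((mv m A ^^ k) u) = (\<Sum>i<m. \<Sum>j<m. (u i * u j) * (mv m A ^^ k) (unitv i) j)"
proof -
  have "(mv m A ^^ k) u i = (\<Sum>j<m. u j * (mv m A ^^ k) (unitv i) j)" if "i < m" for i
  proof -
    have "(mv m A ^^ k) u i = dot m ((mv m A ^^ k) u) (unitv i)" by (simp add: dot_unitv that)
    also have "\<dots> = dot m u ((mv m A ^^ k) (unitv i))" by (rule dot_mv_pow_sym[OF assms])
    finally show ?thesis by (simp add: dot_def)
  qed
  then show ?thesis by (simp add: dot_def[of m u] sum_distrib_left mult_ac)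
qed

lemma tr_pow_moments: "tr_pow m q A = (\<Sum>i<m. dot m (unitv i) ((mv m A ^^ q) (unitv i)))"
  by (simp add: tr_pow_def dot_comm[of m "unitv _"] dot_unitv)

lemma borel_measurable_mv_pow:
  assumes "\<And>i j. i < m \<Longrightarrow> j < m \<Longrightarrow> (\<lambda>x. A x i j) \<in> borel_measurable M" and "i < m"
  shows "(\<lambda>x. (mv m (A x) ^^ q) v i) \<in> borel_measurable M"
  using assms(2)
proof (induction q arbitrary: i)
  case (Suc q)
  then show ?case
    by (auto simp: mv_def[of _ _ "(_ ^^ _) _"] intro!: borel_measurable_sum borel_measurable_times assms)
qed simp

lemma borel_measurable_tr_pow:
  assumes "\<And>i j. i < m \<Longrightarrow> j < m \<Longrightarrow> (\<lambda>x. A x i j) \<in> borel_measurable M"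
  shows "(\<lambda>x. tr_pow m q (A x)) \<in> borel_measurable M"
  unfolding tr_pow_def by (intro borel_measurable_sum borel_measurable_mv_pow[of m A] assms) auto

lemma borel_measurable_shifted_gram:
  assumes "\<And>i. i < m \<Longrightarrow> U i \<in> borel_measurable \<nu>" and "i < m" "j < m"
  shows "(\<lambda>xs. shifted_gram N U k xs i j) \<in> borel_measurable (PiM {..<k} (\<lambda>_. \<nu>))"
proof -
  have "(\<lambda>xs. U i (xs l)) \<in> borel_measurable (PiM {..<k} (\<lambda>_. \<nu>))" if "i < m" "l < k" for i l
    using measurable_compose[OF measurable_component_singleton[of l "{..<k}" "\<lambda>_. \<nu>"] assms(1)[of i]] that by simp
  with assms(2,3) show ?thesis
    unfolding shifted_gram_def
    by (intro borel_measurable_diff borel_measurable_const borel_measurable_sum borel_measurable_times) auto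
qed

text \<open>The factor \<open>1 / real n\<close> makes \<open>n\<close> samples sum to the identity
  in mean. The bound \<open>R\<close> holds at every point, so the margin N - n R is
  deterministic.\<close>

locale isotropic_frame = prob_space \<nu> for \<nu> :: "'b measure" +
  fixes m n :: nat and U :: "nat \<Rightarrow> 'b \<Rightarrow> real" and R :: real
  assumes n_pos: "0 < n" and R_pos: "0 < R"
    and U_meas: "\<And>i. i < m \<Longrightarrow> U i \<in> borel_measurable \<nu>"
    and U_le: "\<And>x. dot m (\<lambda>i. U i x) (\<lambda>i. U i x) \<le> R"
    and U_integrable: "\<And>i j. i < m \<Longrightarrow> j < m \<Longrightarrow> integrable \<nu> (\<lambda>x. U i x * U j x)"
    and U_integral: "\<And>i j. i < m \<Longrightarrow> j < m \<Longrightarrow> (\<integral>x. U i x * U j x \<partial>\<nu>) = (if i = j then 1 / real n else 0)"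
begin

lemma integral_dot_mv_pow:
  assumes "symmetric m A"
  shows "integrable \<nu> (\<lambda>x. dot m (\<lambda>i. U i x) ((mv m A ^^ k) (\<lambda>i. U i x)))"
    and "(\<integral>x. dot m (\<lambda>i. U i x) ((mv m A ^^ k) (\<lambda>i. U i x)) \<partial>\<nu>) = tr_pow m k A / real n"
proof -
  have int: "integrable \<nu> (\<lambda>x. (U i x * U j x) * c)" if "i < m" "j < m" for i j c
    using U_integrable[OF that] by simp
  show "integrable \<nu> (\<lambda>x. dot m (\<lambda>i. U i x) ((mv m A ^^ k) (\<lambda>i. U i x)))"
    unfolding dot_mv_pow_expand[OF assms] by (intro Bochner_Integration.integrable_sum int) auto
  have "(\<integral>x. dot m (\<lambda>i. U i x) ((mv m A ^^ k) (\<lambda>i. U i x)) \<partial>\<nu>)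
      = (\<Sum>i<m. \<Sum>j<m. (\<integral>x. U i x * U j x \<partial>\<nu>) * (mv m A ^^ k) (unitv i) j)"
    unfolding dot_mv_pow_expand[OF assms]
  proof (subst Bochner_Integration.integral_sum)
    show "integrable \<nu> (\<lambda>x. \<Sum>j<m. U i x * U j x * (mv m A ^^ k) (unitv i) j)" if "i \<in> {..<m}" for i
      using that by (intro Bochner_Integration.integrable_sum int) auto
    show "(\<Sum>i<m. \<integral>x. (\<Sum>j<m. U i x * U j x * (mv m A ^^ k) (unitv i) j) \<partial>\<nu>)
        = (\<Sum>i<m. \<Sum>j<m. (\<integral>x. U i x * U j x \<partial>\<nu>) * (mv m A ^^ k) (unitv i) j)"
    proof (rule sum.cong[OF refl])
      fix i assume "i \<in> {..<m}"
      then show "(\<integral>x. (\<Sum>j<m. U i x * U j x * (mv m A ^^ k) (unitv i) j) \<partial>\<nu>)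
          = (\<Sum>j<m. (\<integral>x. U i x * U j x \<partial>\<nu>) * (mv m A ^^ k) (unitv i) j)"
        by (subst Bochner_Integration.integral_sum) (simp_all add: U_integrable)
    qed
  qed
  also have "\<dots> = (\<Sum>i<m. 1 / real n * (mv m A ^^ k) (unitv i) i)"
  proof (intro sum.cong refl)
    fix i assume i: "i \<in> {..<m}"
    have "(\<Sum>j<m. (\<integral>x. U i x * U j x \<partial>\<nu>) * (mv m A ^^ k) (unitv i) j)
        = (\<Sum>j<m. if i = j then 1 / real n * (mv m A ^^ k) (unitv i) j else 0)"
      using i by (intro sum.cong) (auto simp: U_integral)
    then show "(\<Sum>j<m. (\<integral>x. U i x * U j x \<partial>\<nu>) * (mv m A ^^ k) (unitv i) j)
        = 1 / real n * (mv m A ^^ k) (unitv i) i"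
      using i by simp
  qed
  finally show "(\<integral>x. dot m (\<lambda>i. U i x) ((mv m A ^^ k) (\<lambda>i. U i x)) \<partial>\<nu>) = tr_pow m k A / real n"
    by (simp add: tr_pow_def sum_divide_distrib)
qed

text \<open>Given the first \<open>k\<close> samples, the trace after the next one is at most a
  quadratic expression in it, whose mean involves tr A^(q-1). The upper bound \<open>N\<close> on
  the form gives tr A^(q-1) >= tr A^q / N and closes the recursion. With nonnegative integrals,
  iterated integration rests on measurability alone.\<close>

lemma nn_integral_tr_pow_le:
  assumes N: "real n * R < N" and q: "q = 2 * p" "0 < p" and k: "k \<le> n"
  defines "\<rho> \<equiv> real (q - 1) * R / (N - real n * R)"
  defines "\<kappa> \<equiv> real q * ((1 - exp (- \<rho>)) / \<rho>)"
  shows "(\<integral>\<^sup>+ xs. ennreal (tr_pow m q (shifted_gram N U k xs)) \<partial>PiM {..<k} (\<lambda>_. \<nu>))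
    \<le> ennreal (real m * N ^ q * exp (- \<kappa> / (real n * N)) ^ k)"
  using k
proof (induction k)
  case 0
  have "(mv m (shifted_gram N U 0 xs) ^^ q) v i = N ^ q * v i" if "i < m" for xs v i
    using that
  proof (induction q arbitrary: i)
    case (Suc q)
    then show ?case by (simp add: mv_shifted_gram)
  qed simp
  then have "tr_pow m q (shifted_gram N U 0 xs) = real m * N ^ q" for xs
    by (simp add: tr_pow_def unitv_def)
  then show ?case by (simp add: PiM_empty)
next
  case (Suc k)
  let ?PI = "PiM {..<k} (\<lambda>_. \<nu>)"
  define c where "c = exp (- \<kappa> / (real n * N))"
  interpret product_sigma_finite "\<lambda>_ :: nat. \<nu>" by unfold_locales
  have d: "0 < N - real n * R" using N by simp
  have "0 < real n * R" using R_pos n_pos by simp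
  with N have Npos: "0 < N" by linarith
  have q2: "2 \<le> q" using q by simp
  have \<rho>: "0 < \<rho>" using d R_pos q2 by (simp add: \<rho>_def)
  have \<kappa>: "0 \<le> \<kappa>" using \<rho> by (simp add: \<kappa>_def)
  have lb: "(N - real n * R) * dot m v v \<le> dot m v (mv m (shifted_gram N U j xs) v)" if "j \<le> n" for j xs v
  proof -
    have "(N - real n * R) * dot m v v \<le> (N - real j * R) * dot m v v"
      using that R_pos dot_self_nonneg by (intro mult_right_mono) auto
    then show ?thesis using dot_mv_shifted_gram_ge[where U = U, OF U_le, of N j v xs] by linarith
  qed
  have psd: "0 \<le> dot m v (mv m (shifted_gram N U j xs) v)" if "j \<le> n" for j xs v
    by (rule nonneg_if_dot_self_le[OF d lb[OF that]])
  have step: "(\<integral>\<^sup>+ y. ennreal (tr_pow m q (shifted_gram N U (Suc k) (xs(k := y)))) \<partial>\<nu>)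
      \<le> ennreal c * ennreal (tr_pow m q (shifted_gram N U k xs))" for xs
  proof -
    define A where "A = shifted_gram N U k xs"
    have symA: "symmetric m A" unfolding A_def by (rule sym_shifted_gram)
    \<comment> \<open>\<open>g\<close> is quadratic in the new sample, so second moments suffice to
      integrate it.\<close>
    define g where "g y = tr_pow m q A - \<kappa> * dot m (\<lambda>i. U i y) ((mv m A ^^ (q - 1)) (\<lambda>i. U i y))" for y
    have le: "tr_pow m q (shifted_gram N U (Suc k) (xs(k := y))) \<le> g y" for y
      using tr_pow_downdate_le[OF symA d _ U_le R_pos q2, of y] lb[OF Suc.prems, of _ "xs(k := y)"]
      unfolding shifted_gram_Suc A_def g_def \<kappa>_def \<rho>_def by blast
    have nn: "0 \<le> tr_pow m q (shifted_gram N U (Suc k) (xs(k := y)))" for y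
      unfolding tr_pow_moments
      by (intro sum_nonneg moment_nonneg[OF sym_shifted_gram psd[OF Suc.prems]])
    \<comment> \<open>Being above a nonnegative trace, \<open>g\<close> is not truncated by
      \<open>ennreal\<close>.\<close>
    have gnn: "0 \<le> g y" for y using le[of y] nn[of y] by linarith
    have trA: "0 \<le> tr_pow m q A" unfolding tr_pow_moments A_def using Suc.prems
      by (intro sum_nonneg moment_nonneg[OF sym_shifted_gram psd]) auto
    have "(\<integral>\<^sup>+ y. ennreal (tr_pow m q (shifted_gram N U (Suc k) (xs(k := y)))) \<partial>\<nu>)
        \<le> (\<integral>\<^sup>+ y. ennreal (g y) \<partial>\<nu>)"
      by (intro nn_integral_mono ennreal_leI le)
    also have "\<dots> = ennreal (\<integral>y. g y \<partial>\<nu>)"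
      using gnn unfolding g_def
      by (intro nn_integral_eq_integral) (auto intro!: integral_dot_mv_pow[OF symA])
    finally have 1: "(\<integral>\<^sup>+ y. ennreal (tr_pow m q (shifted_gram N U (Suc k) (xs(k := y)))) \<partial>\<nu>)
        \<le> ennreal (\<integral>y. g y \<partial>\<nu>)" .
    have "(\<integral>y. g y \<partial>\<nu>) = tr_pow m q A - \<kappa> * (tr_pow m (q - 1) A / real n)"
      unfolding g_def using integral_dot_mv_pow[OF symA, of "q - 1"] by (simp add: prob_space)
    also have "\<dots> \<le> c * tr_pow m q A"
    proof -
      have qq: "q = Suc (q - 1)" using q2 by simp
      have "tr_pow m (Suc (q - 1)) A \<le> N * tr_pow m (q - 1) A"
        unfolding tr_pow_moments sum_distrib_left A_def
        using Suc.prems by (intro sum_mono moment_Suc_le[OF sym_shifted_gram psd dot_mv_shifted_gram_le]) auto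
      then have "tr_pow m q A / N \<le> tr_pow m (q - 1) A" using Npos qq by (simp add: field_simps)
      then have "tr_pow m q A - \<kappa> * (tr_pow m (q - 1) A / real n) \<le> tr_pow m q A - \<kappa> * (tr_pow m q A / N / real n)"
        using \<kappa> by (intro diff_left_mono mult_left_mono divide_right_mono) auto
      also have "\<dots> = (1 + (- \<kappa> / (real n * N))) * tr_pow m q A"
        using Npos n_pos by (simp add: field_simps)
      \<comment> \<open>The bound 1 + x <= exp x puts the factor into a form whose powers are again
        exponentials.\<close>
      also have "\<dots> \<le> c * tr_pow m q A"
        unfolding c_def using trA by (intro mult_right_mono exp_ge_add_one_self)
      finally show ?thesis .
    qed
    finally have "ennreal (\<integral>y. g y \<partial>\<nu>) \<le> ennreal (c * tr_pow m q A)" by (rule ennreal_leI)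
    also have "\<dots> = ennreal c * ennreal (tr_pow m q A)"
      using trA by (intro ennreal_mult) (auto simp: c_def)
    finally show ?thesis using 1 unfolding A_def by (rule order_trans[rotated])
  qed
  have meas: "(\<lambda>xs. ennreal (tr_pow m q (shifted_gram N U j xs))) \<in> borel_measurable (PiM {..<j} (\<lambda>_. \<nu>))" for j
    by (intro measurable_compose[OF borel_measurable_tr_pow measurable_ennreal]
        borel_measurable_shifted_gram U_meas)
  have "(\<integral>\<^sup>+ xs. ennreal (tr_pow m q (shifted_gram N U (Suc k) xs)) \<partial>PiM {..<Suc k} (\<lambda>_. \<nu>))
      = (\<integral>\<^sup>+ xs. (\<integral>\<^sup>+ y. ennreal (tr_pow m q (shifted_gram N U (Suc k) (xs(k := y)))) \<partial>\<nu>) \<partial>?PI)"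
    using meas[of "Suc k"] unfolding lessThan_Suc by (intro product_nn_integral_insert) auto
  also have "\<dots> \<le> (\<integral>\<^sup>+ xs. ennreal c * ennreal (tr_pow m q (shifted_gram N U k xs)) \<partial>?PI)"
    by (intro nn_integral_mono step)
  also have "\<dots> = ennreal c * (\<integral>\<^sup>+ xs. ennreal (tr_pow m q (shifted_gram N U k xs)) \<partial>?PI)"
    by (intro nn_integral_cmult meas)
  also have "\<dots> \<le> ennreal c * ennreal (real m * N ^ q * c ^ k)"
    using Suc.IH Suc.prems unfolding c_def by (intro mult_left_mono) auto
  also have "\<dots> = ennreal (real m * N ^ q * c ^ Suc k)"
    using Npos by (subst ennreal_mult[symmetric]) (auto simp: c_def mult_ac)
  finally show ?case unfolding c_def .
qed

end

text \<open>Measurability is not evident for a minimum over a root set. The Rayleigh description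
  gives conditions indexed by vectors, and continuity in the vector reduces them to countably many
  rational ones.\<close>

lemma sets_lambda_min_ge:
  assumes meas: "\<And>i j. i < m \<Longrightarrow> j < m \<Longrightarrow> (\<lambda>x. A x i j) \<in> borel_measurable M"
    and sym: "\<And>x. symmetric m (A x)" and m: "1 \<le> m"
  shows "{x \<in> space M. c \<le> lambda_min (mat_of_fun m (A x))} \<in> sets M"
proof -
  define Q where "Q = (\<Pi>\<^sub>E i\<in>{..<m}. (\<rat> :: real set))"
  have Q: "countable Q" unfolding Q_def by (intro countable_PiE) (auto simp: countable_rat)
  have dense: "(\<forall>v. c * dot m v v \<le> dot m v (mv m B v)) \<longleftrightarrow> (\<forall>v\<in>Q. c * dot m v v \<le> dot m v (mv m B v))" for B
  proof (intro iffI allI ballI)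
    fix v assume *: "\<forall>v\<in>Q. c * dot m v v \<le> dot m v (mv m B v)"
    have "\<exists>r\<in>\<rat>. \<bar>r - v i\<bar> < 1 / real (Suc k)" for i k :: nat
    proof -
      obtain r where "r \<in> \<rat>" "v i - 1 / real (Suc k) < r" "r < v i"
        using Rats_dense_in_real[of "v i - 1 / real (Suc k)" "v i"] by auto
      then show ?thesis by (intro bexI[of _ r]) auto
    qed
    then obtain r where r: "\<And>i k. r i k \<in> \<rat>" "\<And>i k. \<bar>r i k - v i\<bar> < 1 / real (Suc k)" by metis
    \<comment> \<open>Restriction to \<open>{..<m}\<close> puts the approximating vectors into the
      extensional product \<open>Q\<close>.\<close>
    define s where "s k = restrict (\<lambda>i. r i k) {..<m}" for k
    have sQ: "s k \<in> Q" for k using r(1) by (auto simp: s_def Q_def)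
    have lim: "(\<lambda>k. s k i) \<longlonglongrightarrow> v i" if "i < m" for i
    proof -
      have "(\<lambda>k. r i k - v i) \<longlonglongrightarrow> 0"
        by (rule Lim_null_comparison[OF _ LIMSEQ_inverse_real_of_nat])
          (use less_imp_le[OF r(2)] in \<open>auto simp: inverse_eq_divide\<close>)
      then have "r i \<longlonglongrightarrow> v i" by (simp add: LIM_zero_iff)
      then show ?thesis using that by (simp add: s_def)
    qed
    have "(\<lambda>k. c * dot m (s k) (s k)) \<longlonglongrightarrow> c * dot m v v"
      unfolding dot_def by (intro tendsto_intros lim) auto
    moreover have "(\<lambda>k. dot m (s k) (mv m B (s k))) \<longlonglongrightarrow> dot m v (mv m B v)"
      unfolding dot_def mv_def by (intro tendsto_intros lim) auto
    ultimately show "c * dot m v v \<le> dot m v (mv m B v)"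
      by (rule LIMSEQ_le) (use * sQ in blast)
  qed auto
  have "{x \<in> space M. \<forall>v\<in>Q. c * dot m v v \<le> dot m v (mv m (A x) v)} \<in> sets M"
  proof (rule sets.sets_Collect_countable_All'[OF _ Q])
    fix v
    have "(\<lambda>x. dot m v (mv m (A x) v)) \<in> borel_measurable M"
      unfolding dot_def mv_def
      by (intro borel_measurable_sum borel_measurable_times borel_measurable_const meas) auto
    then show "{x \<in> space M. c * dot m v v \<le> dot m v (mv m (A x) v)} \<in> sets M" by measurable
  qed
  then show ?thesis by (simp add: lambda_min_ge_iff[OF sym m] dense)
qed

definition frame_gram :: "(nat \<Rightarrow> 'b \<Rightarrow> real) \<Rightarrow> nat \<Rightarrow> (nat \<Rightarrow> 'b) \<Rightarrow> nat \<Rightarrow> nat \<Rightarrow> real" where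
  "frame_gram U k xs i j = (\<Sum>l<k. U i (xs l) * U j (xs l))"

lemma sym_frame_gram: "symmetric m (frame_gram U k xs)"
  by (simp add: symmetric_def frame_gram_def mult.commute)

lemma borel_measurable_frame_gram:
  assumes "\<And>i. i < m \<Longrightarrow> U i \<in> borel_measurable \<nu>" and "i < m" "j < m"
  shows "(\<lambda>xs. frame_gram U k xs i j) \<in> borel_measurable (PiM {..<k} (\<lambda>_. \<nu>))"
proof -
  have "(\<lambda>xs. - shifted_gram 0 U k xs i j) \<in> borel_measurable (PiM {..<k} (\<lambda>_. \<nu>))"
    using assms by (intro borel_measurable_uminus borel_measurable_shifted_gram)
  then show ?thesis by (simp add: shifted_gram_def frame_gram_def)
qed

lemma mv_shifted_gram_frame_gram:
  "i < m \<Longrightarrow> mv m (shifted_gram N U k xs) v i = N * v i - mv m (frame_gram U k xs) v i"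
  using mv_shifted_gram[of i m N U k xs v] mv_shifted_gram[of i m 0 U k xs v]
  by (simp add: mv_def frame_gram_def shifted_gram_def sum_negf)

context isotropic_frame
begin

text \<open>On the bad event an eigenvalue e < c of the Gram matrix gives the eigenvalue N - e > N -
  c > 0 of the shifted matrix, so the trace is at least \<open>(N - c) ^ q\<close>. Dividing by this
  against the factor \<open>N ^ q\<close> yields the denominator.\<close>

lemma measure_lambda_min_less_pow:
  assumes N: "real n * R < N" "c < N" and q: "q = 2 * p" "0 < p" and m: "1 \<le> m"
  defines "\<rho> \<equiv> real (q - 1) * R / (N - real n * R)"
  shows "measure (PiM {..<n} (\<lambda>_. \<nu>))
      {xs \<in> space (PiM {..<n} (\<lambda>_. \<nu>)). \<not> c \<le> lambda_min (mat_of_fun m (frame_gram U n xs))}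
    \<le> real m * exp (- (real q / N * ((1 - exp (- \<rho>)) / \<rho>))) / (1 - c / N) ^ q"
proof -
  let ?P = "PiM {..<n} (\<lambda>_. \<nu>)"
  define \<kappa> where "\<kappa> = real q * ((1 - exp (- \<rho>)) / \<rho>)"
  let ?S = "{xs \<in> space ?P. \<not> c \<le> lambda_min (mat_of_fun m (frame_gram U n xs))}"
  define t where "t xs = tr_pow m q (shifted_gram N U n xs)" for xs
  define b where "b = (N - c) ^ q"
  have b: "0 < b" using N by (simp add: b_def)
  have "0 < real n * R" using R_pos n_pos by simp
  with N have Npos: "0 < N" by linarith
  interpret P: prob_space ?P by (rule prob_space_PiM) (rule prob_space_axioms)
  have tm: "t \<in> borel_measurable ?P"
    unfolding t_def by (intro borel_measurable_tr_pow borel_measurable_shifted_gram U_meas)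
  have "b \<le> t xs" if xs: "xs \<in> ?S" for xs
  proof -
    obtain e where e: "e < c" "eigenvalue (mat_of_fun m (frame_gram U n xs)) e"
      using lambda_min_less_imp_eigenvalue[OF sym_frame_gram m] xs by blast
    then obtain v where v: "0 < dot m v v" "\<And>i. i < m \<Longrightarrow> mv m (frame_gram U n xs) v i = e * v i"
      by (auto simp: eigenvalue_mat_of_fun)
    have "b \<le> (N - e) ^ q" unfolding b_def using N e by (intro power_mono) auto
    also have "\<dots> \<le> t xs"
      unfolding t_def q
      by (rule tr_pow_ge_eigenvalue[OF sym_shifted_gram _ v(1)])
        (simp add: mv_shifted_gram_frame_gram v(2) algebra_simps)
    finally show ?thesis .
  qed
  moreover have "1 \<le> ennreal (1 / b) * ennreal (t xs)" if "b \<le> t xs" for xs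
    using b that by (subst ennreal_mult[symmetric]) (simp_all add: field_simps)
  ultimately have "?S \<subseteq> {xs \<in> space ?P. 1 \<le> ennreal (1 / b) * ennreal (t xs)}"
    by blast
  then have "emeasure ?P ?S \<le> emeasure ?P {xs \<in> space ?P. 1 \<le> ennreal (1 / b) * ennreal (t xs)}"
    using tm by (intro emeasure_mono) auto
  also have "\<dots> \<le> ennreal (1 / b) * (\<integral>\<^sup>+ xs. ennreal (t xs) * indicator (space ?P) xs \<partial>?P)"
    using tm by (intro nn_integral_Markov_inequality) auto
  also have "(\<integral>\<^sup>+ xs. ennreal (t xs) * indicator (space ?P) xs \<partial>?P) = (\<integral>\<^sup>+ xs. ennreal (t xs) \<partial>?P)"
    by (intro nn_integral_cong) simp
  also have "ennreal (1 / b) * (\<integral>\<^sup>+ xs. ennreal (t xs) \<partial>?P)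
      \<le> ennreal (1 / b) * ennreal (real m * N ^ q * exp (- \<kappa> / (real n * N)) ^ n)"
    unfolding t_def \<kappa>_def \<rho>_def
    by (intro mult_left_mono nn_integral_tr_pow_le[OF N(1) q order_refl]) simp
  also have "\<dots> = ennreal (1 / b * (real m * N ^ q * exp (- \<kappa> / (real n * N)) ^ n))"
    using b Npos by (subst ennreal_mult) auto
  also have "1 / b * (real m * N ^ q * exp (- \<kappa> / (real n * N)) ^ n)
      = real m * exp (- (real q / N * ((1 - exp (- \<rho>)) / \<rho>))) / (1 - c / N) ^ q"
  proof -
    \<comment> \<open>The \<open>n\<close> equal factors cancel the \<open>n\<close> in the
      exponent.\<close>
    have "exp (- \<kappa> / (real n * N)) ^ n = exp (- (real q / N * ((1 - exp (- \<rho>)) / \<rho>)))"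
      using n_pos Npos by (simp add: exp_of_nat_mult[symmetric] \<kappa>_def)
    moreover have "(1 - c / N) ^ q = b / N ^ q"
      using Npos by (simp add: b_def power_divide[symmetric] diff_divide_distrib)
    ultimately show ?thesis by simp
  qed
  finally have "emeasure ?P ?S \<le> ennreal (real m * exp (- (real q / N * ((1 - exp (- \<rho>)) / \<rho>))) / (1 - c / N) ^ q)" .
  then show ?thesis
    using N Npos by (simp add: P.emeasure_eq_measure)
qed

text \<open>Taking N = q / \<theta> and letting q tend to infinity turns the powers into exponentials.\<close>

lemma measure_lambda_min_less:
  assumes m: "1 \<le> m" and \<theta>: "0 < \<theta>"
  shows "measure (PiM {..<n} (\<lambda>_. \<nu>))
      {xs \<in> space (PiM {..<n} (\<lambda>_. \<nu>)). \<not> c \<le> lambda_min (mat_of_fun m (frame_gram U n xs))}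
    \<le> real m * exp (\<theta> * c - (1 - exp (- \<theta> * R)) / R)" (is "?L \<le> _")
proof -
  \<comment> \<open>The rate for q = 2 p and N = 2 p / \<theta>, with the subtraction moved to the
    reals; in the limit neither the 1 nor the term n R survives.\<close>
  define \<rho> where "\<rho> p = (2 * real p - 1) * R / (2 * real p / \<theta> - real n * R)" for p
  define B where "B p = real m * exp (- (\<theta> * ((1 - exp (- \<rho> p)) / \<rho> p))) / (1 + (- \<theta> * c) / real (2 * p)) ^ (2 * p)" for p :: nat
  have "\<rho> \<longlonglongrightarrow> \<theta> * R"
    unfolding \<rho>_def using \<theta> R_pos by real_asymp
  moreover have "(\<lambda>p. (1 + (- \<theta> * c) / real (2 * p)) ^ (2 * p)) \<longlonglongrightarrow> exp (- \<theta> * c)"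
    by (rule filterlim_compose[OF tendsto_exp_limit_sequentially[of "- \<theta> * c"]])
      (rule mult_nat_left_at_top, simp)
  ultimately have "B \<longlonglongrightarrow> real m * exp (- (\<theta> * ((1 - exp (- (\<theta> * R))) / (\<theta> * R)))) / exp (- \<theta> * c)"
    unfolding B_def using \<theta> R_pos by (intro tendsto_intros) auto
  also have "real m * exp (- (\<theta> * ((1 - exp (- (\<theta> * R))) / (\<theta> * R)))) / exp (- \<theta> * c)
      = real m * exp (\<theta> * c - (1 - exp (- \<theta> * R)) / R)"
  proof -
    have "\<theta> * ((1 - exp (- (\<theta> * R))) / (\<theta> * R)) = (1 - exp (- \<theta> * R)) / R" using \<theta> by simp
    then have "exp (- (\<theta> * ((1 - exp (- (\<theta> * R))) / (\<theta> * R)))) / exp (- \<theta> * c)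
        = exp (- ((1 - exp (- \<theta> * R)) / R) - (- \<theta> * c))"
      by (simp only: exp_diff)
    moreover have "real m * x / y = real m * (x / y)" for x y by simp
    ultimately show ?thesis by (simp only:) (simp add: algebra_simps)
  qed
  finally have lim: "B \<longlonglongrightarrow> real m * exp (\<theta> * c - (1 - exp (- \<theta> * R)) / R)" .
  have "filterlim (\<lambda>p. 2 * real p / \<theta>) at_top sequentially" using \<theta> by real_asymp
  \<comment> \<open>Both requirements on N, exceeding n R and exceeding \<open>c\<close>, hold from
    some \<open>p\<close> on.\<close>
  then have "eventually (\<lambda>p. max (real n * R) c < 2 * real p / \<theta>) sequentially"
    unfolding filterlim_at_top_dense by blast
  then have "eventually (\<lambda>p. ?L \<le> B p) sequentially"
    using eventually_gt_at_top[of 0]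
  proof eventually_elim
    case (elim p)
    have "real (2 * p - 1) = 2 * real p - 1" using elim by (simp add: of_nat_diff)
    moreover have "(2 * real p) / (2 * real p / \<theta>) = \<theta>" using elim by simp
    ultimately show ?case
      using measure_lambda_min_less_pow[of "2 * real p / \<theta>" c "2 * p" p] elim m
      by (simp add: B_def \<rho>_def mult_ac)
  qed
  with lim show ?thesis by (intro tendsto_lowerbound) auto
qed

end

section \<open>Weighted least squares\<close>

definition basis_comb :: "nat \<Rightarrow> (nat \<Rightarrow> 'b \<Rightarrow> real) \<Rightarrow> (nat \<Rightarrow> real) \<Rightarrow> 'b \<Rightarrow> real" where
  "basis_comb m \<phi> c x = (\<Sum>i<m. c i * \<phi> i x)"

lemma Vm_eq: "Vm m \<phi> = range (basis_comb m \<phi>)"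
  by (auto simp: Vm_def basis_comb_def fun_eq_iff image_def)

text \<open>Dividing by the root of n w absorbs both the weight and the average: the Gram matrix
  becomes a plain sum of u u^T and the empirical norm a Euclidean one.\<close>

definition scaled :: "nat \<Rightarrow> ('b \<Rightarrow> real) \<Rightarrow> ('b \<Rightarrow> real) \<Rightarrow> 'b \<Rightarrow> real" where
  "scaled n w f x = f x / sqrt (real n * w x)"

lemma scaled_mult:
  assumes "0 < w x"
  shows "scaled n w f x * scaled n w g x = f x * g x / (real n * w x)"
  using assms by (simp add: scaled_def)

lemma gram_w_eq_frame_gram:
  assumes "\<And>x. 0 < w x"
  shows "gram_w m \<phi> n w xs = mat_of_fun m (frame_gram (\<lambda>i. scaled n w (\<phi> i)) n xs)"
  by (rule eq_matI) (simp_all add: gram_w_def frame_gram_def scaled_mult[where w = w, OF assms] sum_distrib_left)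

lemma empnorm_eq_scaled:
  assumes "\<And>x. 0 < w x"
  shows "empnorm n w xs f = sqrt (\<Sum>l<n. (scaled n w f (xs l))\<^sup>2)"
  by (simp add: empnorm_def power2_eq_square scaled_mult[where w = w, OF assms] sum_distrib_left)

lemma mv_frame_gram:
  "mv m (frame_gram U n xs) v i = (\<Sum>l<n. U i (xs l) * dot m (\<lambda>i. U i (xs l)) v)"
  by (simp add: mv_def frame_gram_def dot_def sum_distrib_right sum_distrib_left mult_ac) (rule sum.swap)

lemma dot_mv_frame_gram:
  "dot m v (mv m (frame_gram U n xs) v) = (\<Sum>l<n. (dot m (\<lambda>i. U i (xs l)) v)\<^sup>2)"
  using dot_mv_shifted_gram[of m v 0 U n xs]
  by (simp add: shifted_gram_def frame_gram_def[symmetric] mv_def dot_def sum_negf)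

text \<open>The sample is fixed here; coercivity is all that least squares takes from the good
  event.\<close>

locale coercive_least_squares =
  fixes m n :: nat and \<phi> :: "nat \<Rightarrow> 'b \<Rightarrow> real" and w :: "'b \<Rightarrow> real" and xs :: "nat \<Rightarrow> 'b" and \<gamma> :: real
  assumes w_pos: "\<And>x. 0 < w x" and \<gamma>_pos: "0 < \<gamma>"
    and coercive: "\<And>v. \<gamma> * dot m v v \<le> dot m v (mv m (frame_gram (\<lambda>i. scaled n w (\<phi> i)) n xs) v)"
begin

lemma gram_injective:
  assumes "0 < dot m v v"
  shows "\<exists>i<m. mv m (frame_gram (\<lambda>i. scaled n w (\<phi> i)) n xs) v i \<noteq> 0"
proof (rule ccontr)
  assume "\<not> ?thesis"
  then have "dot m v (mv m (frame_gram (\<lambda>i. scaled n w (\<phi> i)) n xs) v) = 0"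
    by (auto simp: dot_def intro!: sum.neutral)
  with coercive[of v] mult_pos_pos[OF \<gamma>_pos assms] show False by linarith
qed

lemma invertible_gram: "invertible_mat (gram_w m \<phi> n w xs)"
  unfolding gram_w_eq_frame_gram[where w = w, OF w_pos] by (rule injective_imp_invertible(1)[OF gram_injective])

text \<open>The quadratic form in \<open>c - b\<close> left over by Pythagoras is coercive, which
  serves twice: it makes the minimiser unique, as \<open>THE\<close> demands, and it bounds the
  coefficient distance from any competitor \<open>c\<close>.\<close>

lemma wls_proj_exists:
  "\<exists>b. wls_proj m \<phi> n w xs f = basis_comb m \<phi> b \<and>
     (\<forall>c. \<gamma> * dot m (\<lambda>i. c i - b i) (\<lambda>i. c i - b i) \<le> (empnorm n w xs (\<lambda>x. f x - basis_comb m \<phi> c x))\<^sup>2)"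
proof -
  let ?U = "\<lambda>i. scaled n w (\<phi> i)"
  let ?G = "frame_gram ?U n xs"
  define F where "F l = scaled n w f (xs l)" for l
  define E where "E c = (\<Sum>l<n. (F l - dot m (\<lambda>i. ?U i (xs l)) c)\<^sup>2)" for c
  have emp: "empnorm n w xs (\<lambda>x. f x - basis_comb m \<phi> c x) = sqrt (E c)" for c
  proof -
    have "scaled n w (\<lambda>x. f x - basis_comb m \<phi> c x) y = scaled n w f y - dot m (\<lambda>i. ?U i y) c" for y
      by (simp add: scaled_def basis_comb_def dot_def diff_divide_distrib sum_divide_distrib mult.commute)
    then show ?thesis by (simp add: empnorm_eq_scaled[where w = w, OF w_pos] E_def F_def)
  qed
  obtain B where B: "\<And>v i. i < m \<Longrightarrow> mv m ?G (mv m B v) i = v i"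
    using injective_imp_invertible(2)[OF gram_injective] by blast
  \<comment> \<open>\<open>B\<close> inverts the Gram matrix, so \<open>b\<close> solves the normal
    equations for the data \<open>F\<close>.\<close>
  define b where "b = mv m B (\<lambda>i. \<Sum>l<n. ?U i (xs l) * F l)"
  have normal: "(\<Sum>l<n. ?U i (xs l) * (F l - dot m (\<lambda>i. ?U i (xs l)) b)) = 0" if "i < m" for i
    using B[OF that, of "\<lambda>i. \<Sum>l<n. ?U i (xs l) * F l"]
    by (simp add: b_def mv_frame_gram right_diff_distrib sum_subtractf)
  have pyth: "E c = E b + dot m (\<lambda>i. c i - b i) (mv m ?G (\<lambda>i. c i - b i))" for c
  proof -
    define d where "d = (\<lambda>i. c i - b i)"
    define r where "r l = F l - dot m (\<lambda>i. ?U i (xs l)) b" for l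
    have sp: "F l - dot m (\<lambda>i. ?U i (xs l)) c = r l - dot m (\<lambda>i. ?U i (xs l)) d" for l
      by (simp add: r_def d_def dot_def right_diff_distrib sum_subtractf)
    have "(\<Sum>l<n. r l * dot m (\<lambda>i. ?U i (xs l)) d) = (\<Sum>i<m. d i * (\<Sum>l<n. ?U i (xs l) * r l))"
      by (simp add: dot_def sum_distrib_left mult_ac) (rule sum.swap)
    also have "\<dots> = 0" using normal by (intro sum.neutral) (auto simp: r_def)
    finally have orth: "(\<Sum>l<n. r l * dot m (\<lambda>i. ?U i (xs l)) d) = 0" .
    have Eb: "E b = (\<Sum>l<n. (r l)\<^sup>2)" by (simp add: E_def r_def)
    have "E c = (\<Sum>l<n. (r l)\<^sup>2 + (dot m (\<lambda>i. ?U i (xs l)) d)\<^sup>2 - 2 * (r l * dot m (\<lambda>i. ?U i (xs l)) d))"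
      unfolding E_def sp by (intro sum.cong) (auto simp: power2_eq_square algebra_simps)
    also have "\<dots> = E b + dot m d (mv m ?G d)"
      by (simp add: sum.distrib sum_subtractf sum_distrib_left[symmetric] orth dot_mv_frame_gram Eb)
    finally show ?thesis by (simp add: d_def)
  qed
  have gap: "\<gamma> * dot m (\<lambda>i. c i - b i) (\<lambda>i. c i - b i) \<le> E c - E b" for c
    using coercive[of "\<lambda>i. c i - b i"] pyth[of c] by simp
  have E0: "0 \<le> E c" for c by (simp add: E_def sum_nonneg)
  have min: "E b \<le> E c" for c
    using nonneg_if_dot_self_le[OF \<gamma>_pos gap[of c]] by simp
  have "wls_proj m \<phi> n w xs f = basis_comb m \<phi> b"
    unfolding wls_proj_def
  proof (rule the_equality)
    show "basis_comb m \<phi> b \<in> Vm m \<phi> \<and> (\<forall>g'\<in>Vm m \<phi>.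
        empnorm n w xs (\<lambda>x. f x - basis_comb m \<phi> b x) \<le> empnorm n w xs (\<lambda>x. f x - g' x))"
      by (auto simp: Vm_eq emp min)
  next
    fix g assume g: "g \<in> Vm m \<phi> \<and> (\<forall>g'\<in>Vm m \<phi>.
        empnorm n w xs (\<lambda>x. f x - g x) \<le> empnorm n w xs (\<lambda>x. f x - g' x))"
    then obtain c where c: "g = basis_comb m \<phi> c" by (auto simp: Vm_eq)
    with g have "E c \<le> E b" by (auto simp: Vm_eq emp)
    with gap[of c] have "\<gamma> * dot m (\<lambda>i. c i - b i) (\<lambda>i. c i - b i) \<le> 0" by linarith
    with \<gamma>_pos have "dot m (\<lambda>i. c i - b i) (\<lambda>i. c i - b i) \<le> 0" by (simp add: mult_le_0_iff)
    \<comment> \<open>Equal coefficients give equality of the functions everywhere, not merely at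
      the sample points.\<close>
    then have "\<forall>i<m. c i = b i" using dot_self_pos_iff[of m "\<lambda>i. c i - b i"] by auto
    then show "g = basis_comb m \<phi> b" by (simp add: c fun_eq_iff basis_comb_def)
  qed
  \<comment> \<open>The minimal squared error \<open>E b\<close> is nonnegative and is
    dropped.\<close>
  moreover have "\<gamma> * dot m (\<lambda>i. c i - b i) (\<lambda>i. c i - b i) \<le> (empnorm n w xs (\<lambda>x. f x - basis_comb m \<phi> c x))\<^sup>2" for c
    using gap[of c] E0[of b] E0[of c] by (simp add: emp)
  ultimately show ?thesis by blast
qed

end

section \<open>Square integrable functions and orthonormal combinations\<close>

lemma integrable_mult_of_squares:
  fixes f g :: "'b \<Rightarrow> real"
  assumes "f \<in> borel_measurable M" "integrable M (\<lambda>x. (f x)\<^sup>2)"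
    and "g \<in> borel_measurable M" "integrable M (\<lambda>x. (g x)\<^sup>2)"
  shows "integrable M (\<lambda>x. f x * g x)"
proof (rule Bochner_Integration.integrable_bound)
  show "integrable M (\<lambda>x. (f x)\<^sup>2 + (g x)\<^sup>2)" using assms by simp
  have "\<bar>a * b\<bar> \<le> \<bar>a\<^sup>2 + b\<^sup>2\<bar>" for a b :: real
  proof -
    have "2 * (\<bar>a\<bar> * \<bar>b\<bar>) \<le> a\<^sup>2 + b\<^sup>2" using sum_squares_bound[of "\<bar>a\<bar>" "\<bar>b\<bar>"] by (simp add: mult.assoc)
    moreover have "0 \<le> \<bar>a\<bar> * \<bar>b\<bar>" by simp
    ultimately have "\<bar>a\<bar> * \<bar>b\<bar> \<le> a\<^sup>2 + b\<^sup>2" by linarith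
    then show ?thesis by (simp add: abs_mult)
  qed
  then show "AE x in M. norm (f x * g x) \<le> norm ((f x)\<^sup>2 + (g x)\<^sup>2)" by simp
qed (use assms in measurable)

lemma L2norm_triangle:
  assumes f: "f \<in> borel_measurable M" "integrable M (\<lambda>x. (f x)\<^sup>2)"
    and g: "g \<in> borel_measurable M" "integrable M (\<lambda>x. (g x)\<^sup>2)"
  shows "L2norm M (\<lambda>x. f x + g x) \<le> L2norm M f + L2norm M g"
proof -
  define a b c where "a = (\<integral>x. (g x)\<^sup>2 \<partial>M)" and "b = (\<integral>x. f x * g x \<partial>M)" and "c = (\<integral>x. (f x)\<^sup>2 \<partial>M)"
  note fg = integrable_mult_of_squares[OF f g]
  have expand: "(\<integral>x. (f x + t * g x)\<^sup>2 \<partial>M) = a * t\<^sup>2 + 2 * b * t + c" for t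
  proof -
    have "(\<integral>x. (f x + t * g x)\<^sup>2 \<partial>M) = (\<integral>x. (f x)\<^sup>2 + (2 * t) * (f x * g x) + t\<^sup>2 * (g x)\<^sup>2 \<partial>M)"
      by (intro Bochner_Integration.integral_cong) (auto simp: power2_eq_square algebra_simps)
    also have "\<dots> = a * t\<^sup>2 + 2 * b * t + c" using f g fg by (simp add: a_def b_def c_def)
    finally show ?thesis .
  qed
  have "0 \<le> a * t\<^sup>2 + 2 * b * t + c" for t
    unfolding expand[symmetric] by simp
  then have "b\<^sup>2 \<le> a * c" by (rule quadratic_nonneg_imp_discriminant) (auto simp: a_def c_def)
  then have "\<bar>b\<bar> \<le> sqrt (a * c)" by (simp add: real_le_rsqrt)
  then have "b \<le> sqrt a * sqrt c" by (simp add: real_sqrt_mult)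
  moreover have nn: "0 \<le> a" "0 \<le> c" by (simp_all add: a_def c_def)
  ultimately have "a + 2 * b + c \<le> (sqrt c + sqrt a)\<^sup>2"
    by (simp add: power2_sum mult_ac)
  then have "sqrt (a + 2 * b + c) \<le> sqrt c + sqrt a"
    using nn by (intro real_le_lsqrt) (auto simp: expand[of 1, simplified, symmetric])
  then show ?thesis using expand[of 1] by (simp add: L2norm_def a_def c_def)
qed

lemma orthonormal_comb:
  assumes "orthonormal_L2 M m \<phi>"
  shows "basis_comb m \<phi> c \<in> borel_measurable M"
    and "integrable M (\<lambda>x. (basis_comb m \<phi> c x)\<^sup>2)"
    and "L2norm M (basis_comb m \<phi> c) = sqrt (dot m c c)"
proof -
  have meas: "\<phi> i \<in> borel_measurable M" if "i < m" for i using assms that by (simp add: orthonormal_L2_def)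
  have int: "integrable M (\<lambda>x. \<phi> i x * \<phi> j x)" if "i < m" "j < m" for i j
    using assms that by (intro integrable_mult_of_squares) (auto simp: orthonormal_L2_def)
  show "basis_comb m \<phi> c \<in> borel_measurable M"
    unfolding basis_comb_def[abs_def] using meas by (intro borel_measurable_sum) auto
  have sq: "(basis_comb m \<phi> c x)\<^sup>2 = (\<Sum>i<m. \<Sum>j<m. c i * c j * (\<phi> i x * \<phi> j x))" for x
    by (simp add: basis_comb_def power2_eq_square sum_product mult_ac)
  have int': "integrable M (\<lambda>x. c i * c j * (\<phi> i x * \<phi> j x))" if "i < m" "j < m" for i j
    using int[OF that] by simp
  show "integrable M (\<lambda>x. (basis_comb m \<phi> c x)\<^sup>2)"
    unfolding sq by (intro Bochner_Integration.integrable_sum int') auto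
  have "(\<integral>x. (basis_comb m \<phi> c x)\<^sup>2 \<partial>M) = (\<Sum>i<m. \<integral>x. (\<Sum>j<m. c i * c j * (\<phi> i x * \<phi> j x)) \<partial>M)"
    unfolding sq using int'
    by (intro Bochner_Integration.integral_sum Bochner_Integration.integrable_sum) auto
  also have "\<dots> = (\<Sum>i<m. \<Sum>j<m. c i * c j * (if i = j then 1 else 0))"
  proof (rule sum.cong[OF refl])
    fix i assume i: "i \<in> {..<m}"
    have "(\<integral>x. (\<Sum>j<m. c i * c j * (\<phi> i x * \<phi> j x)) \<partial>M) = (\<Sum>j<m. \<integral>x. c i * c j * (\<phi> i x * \<phi> j x) \<partial>M)"
      using int' i by (intro Bochner_Integration.integral_sum) auto
    also have "\<dots> = (\<Sum>j<m. c i * c j * (if i = j then 1 else 0))"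
      using assms i by (intro sum.cong) (auto simp: orthonormal_L2_def)
    finally show "(\<integral>x. (\<Sum>j<m. c i * c j * (\<phi> i x * \<phi> j x)) \<partial>M) = (\<Sum>j<m. c i * c j * (if i = j then 1 else 0))" .
  qed
  also have "\<dots> = dot m c c" by (simp add: dot_def if_distrib cong: if_cong)
  finally show "L2norm M (basis_comb m \<phi> c) = sqrt (dot m c c)" by (simp add: L2norm_def)
qed

text \<open>The inequality ln y < y - 1 is strict at y = 1 / (1 - \<delta>), which differs from
  1.\<close>

lemma c_delta_pos:
  assumes "0 < \<delta>" "\<delta> < 1"
  shows "0 < c_delta \<delta>"
proof -
  have "ln (1 / (1 - \<delta>)) < 1 / (1 - \<delta>) - 1"
    using assms ln_le_minus_one[of "1 / (1 - \<delta>)"] ln_eq_minus_one[of "1 / (1 - \<delta>)"] by fastforce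
  also have "1 / (1 - \<delta>) - 1 = \<delta> / (1 - \<delta>)" using assms by (simp add: field_simps)
  finally have "- ln (1 - \<delta>) < \<delta> / (1 - \<delta>)" using assms by (simp add: ln_div)
  then show ?thesis using assms by (simp add: c_delta_def field_simps)
qed

section \<open>The mixture density and the probability of the good event\<close>

locale weighted_design = prob_space M for M :: "'b measure" +
  fixes m n :: nat and \<phi> :: "nat \<Rightarrow> 'b \<Rightarrow> real" and h w :: "'b \<Rightarrow> real" and \<alpha> :: real
  assumes m: "1 \<le> m" and n: "0 < n"
    and ONB: "orthonormal_L2 M m \<phi>"
    and h_meas: "h \<in> borel_measurable M" and h_pos: "\<And>x. 0 < h x"
    and h_int: "integrable M h" and h_dens: "(\<integral>x. h x \<partial>M) = 1"
    and \<alpha>: "0 < \<alpha>" "\<alpha> < 1"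
    and w_def: "w = (\<lambda>x. \<alpha> * wm m \<phi> x + (1 - \<alpha>) * h x)"
begin

lemma wm_nonneg: "0 \<le> wm m \<phi> x"
  by (simp add: wm_def sum_nonneg)

text \<open>The two halves of the mixture act separately: this one bounds the frame vectors and
  drives the eigenvalue estimate, while the share of \<open>h\<close> controls the error in the norm
  of \<open>H\<close>.\<close>

lemma w_ge_wm: "\<alpha> * wm m \<phi> x \<le> w x"
  using \<alpha> h_pos[of x] by (simp add: w_def)

lemma w_ge_h: "(1 - \<alpha>) * h x \<le> w x"
  using \<alpha> wm_nonneg[of x] by (simp add: w_def)

text \<open>All basis functions may vanish at a point, so positivity comes from
  \<open>h\<close>.\<close>

lemma w_pos: "0 < w x"
proof -
  have "0 < (1 - \<alpha>) * h x" using \<alpha> h_pos[of x] by simp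
  with w_ge_h[of x] show ?thesis by linarith
qed

lemma \<phi>_meas: "i < m \<Longrightarrow> \<phi> i \<in> borel_measurable M"
  using ONB by (simp add: orthonormal_L2_def)

lemma integrable_\<phi>: "i < m \<Longrightarrow> j < m \<Longrightarrow> integrable M (\<lambda>x. \<phi> i x * \<phi> j x)"
  using ONB by (intro integrable_mult_of_squares) (auto simp: orthonormal_L2_def)

lemma integral_\<phi>: "i < m \<Longrightarrow> j < m \<Longrightarrow> (\<integral>x. \<phi> i x * \<phi> j x \<partial>M) = (if i = j then 1 else 0)"
  using ONB by (simp add: orthonormal_L2_def)

lemma integrable_wm: "integrable M (wm m \<phi>)"
  unfolding wm_def[abs_def] using ONB
  by (intro integrable_mult_right Bochner_Integration.integrable_sum) (auto simp: orthonormal_L2_def)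

lemma integral_wm: "(\<integral>x. wm m \<phi> x \<partial>M) = 1"
proof -
  have "(\<integral>x. (\<Sum>i<m. (\<phi> i x)\<^sup>2) \<partial>M) = (\<Sum>i<m. \<integral>x. (\<phi> i x)\<^sup>2 \<partial>M)"
    using ONB by (intro Bochner_Integration.integral_sum) (auto simp: orthonormal_L2_def)
  also have "\<dots> = real m"
    using integral_\<phi> by (simp add: power2_eq_square)
  finally show ?thesis using m by (simp add: wm_def)
qed

lemma w_meas: "w \<in> borel_measurable M"
  unfolding w_def using h_meas borel_measurable_integrable[OF integrable_wm] by measurable

definition \<nu> :: "'b measure" where "\<nu> = density M (\<lambda>x. ennreal (w x))"

lemma prob_space_\<nu>: "prob_space \<nu>"
proof
  have "(\<integral>\<^sup>+x. ennreal (w x) \<partial>M) = ennreal (\<integral>x. w x \<partial>M)"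
    using integrable_wm h_int less_imp_le[OF w_pos]
    by (intro nn_integral_eq_integral) (auto simp: w_def)
  also have "(\<integral>x. w x \<partial>M) = 1"
    using integrable_wm h_int by (simp add: w_def integral_wm h_dens)
  finally show "emeasure \<nu> (space \<nu>) = 1"
    using w_meas by (simp add: \<nu>_def emeasure_density cong: nn_integral_cong)
qed

text \<open>The sampling density \<open>w\<close> cancels the division by \<open>w\<close> in the
  products, which leaves orthonormality divided by \<open>n\<close>. The squared length of a frame
  vector is m w_m / (n w), and w >= \<alpha> w_m gives the constant.\<close>

lemma isotropic_frame_scaled:
  "isotropic_frame \<nu> m n (\<lambda>i. scaled n w (\<phi> i)) (real m / (\<alpha> * real n))"
proof -
  interpret \<nu>: prob_space \<nu> by (rule prob_space_\<nu>)
  have prod: "w x * (scaled n w (\<phi> i) x * scaled n w (\<phi> j) x) = \<phi> i x * \<phi> j x / real n" for i j x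
    using w_pos[of x] by (simp add: scaled_mult[where w = w, OF w_pos])
  have meas: "(\<lambda>x. scaled n w (\<phi> i) x) \<in> borel_measurable M" if "i < m" for i
    unfolding scaled_def using \<phi>_meas[OF that] w_meas by measurable
  show ?thesis
  proof
    show "0 < n" by (rule n)
    show "0 < real m / (\<alpha> * real n)" using m n \<alpha> by simp
    show "scaled n w (\<phi> i) \<in> borel_measurable \<nu>" if "i < m" for i
      using meas[OF that] by (simp add: \<nu>_def)
    show "dot m (\<lambda>i. scaled n w (\<phi> i) x) (\<lambda>i. scaled n w (\<phi> i) x) \<le> real m / (\<alpha> * real n)" for x
    proof -
      have "dot m (\<lambda>i. scaled n w (\<phi> i) x) (\<lambda>i. scaled n w (\<phi> i) x) = real m * wm m \<phi> x / (real n * w x)"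
        using m by (simp add: dot_def scaled_mult[where w = w, OF w_pos] wm_def power2_eq_square
            sum_divide_distrib[symmetric])
      also have "\<dots> \<le> real m / (\<alpha> * real n)"
        using mult_left_mono[OF w_ge_wm[of x], of "real m"] w_pos[of x] n \<alpha> by (simp add: field_simps)
      finally show ?thesis .
    qed
    fix i j assume ij: "i < m" "j < m"
    show "integrable \<nu> (\<lambda>x. scaled n w (\<phi> i) x * scaled n w (\<phi> j) x)"
      unfolding \<nu>_def using meas[OF ij(1)] meas[OF ij(2)] w_meas less_imp_le[OF w_pos] integrable_\<phi>[OF ij]
      by (subst integrable_real_density) (auto simp: prod)
    show "(\<integral>x. scaled n w (\<phi> i) x * scaled n w (\<phi> j) x \<partial>\<nu>) = (if i = j then 1 / real n else 0)"
      unfolding \<nu>_def using meas[OF ij(1)] meas[OF ij(2)] w_meas less_imp_le[OF w_pos]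
      by (subst integral_real_density) (auto simp: prod integral_\<phi>[OF ij])
  qed
qed

lemma sets_good_gram:
  "{xs \<in> space (PiM {..<n} (\<lambda>_. \<nu>)). c \<le> lambda_min (gram_w m \<phi> n w xs)} \<in> sets (PiM {..<n} (\<lambda>_. \<nu>))"
proof -
  interpret F: isotropic_frame \<nu> m n "\<lambda>i. scaled n w (\<phi> i)" "real m / (\<alpha> * real n)"
    by (rule isotropic_frame_scaled)
  show ?thesis
    unfolding gram_w_eq_frame_gram[where w = w, OF w_pos]
    by (intro sets_lambda_min_ge sym_frame_gram m borel_measurable_frame_gram F.U_meas)
qed

lemma measure_good_gram:
  assumes \<delta>: "0 < \<delta>" "\<delta> < 1" and \<eta>: "0 < \<eta>"
    and large: "real n \<ge> (1 / c_delta \<delta>) * (1 / \<alpha>) * real m * ln (real m / \<eta>)"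
  shows "1 - \<eta> \<le> measure (PiM {..<n} (\<lambda>_. \<nu>))
    {xs \<in> space (PiM {..<n} (\<lambda>_. \<nu>)). 1 - \<delta> \<le> lambda_min (gram_w m \<phi> n w xs)}"
proof -
  let ?P = "PiM {..<n} (\<lambda>_. \<nu>)"
  define R where "R = real m / (\<alpha> * real n)"
  \<comment> \<open>The minimiser of the exponent: its derivative
    \<open>(1 - \<delta>) - exp (- \<theta> * R)\<close> vanishes here, and the minimum is
    \<open>- c_delta \<delta> / R\<close>.\<close>
  define \<theta> where "\<theta> = - ln (1 - \<delta>) / R"
  have R: "0 < R" using m n \<alpha> by (simp add: R_def)
  have \<theta>: "0 < \<theta>" unfolding \<theta>_def using R \<delta> by (intro divide_pos_pos) simp_all
  interpret F: isotropic_frame \<nu> m n "\<lambda>i. scaled n w (\<phi> i)" R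
    unfolding R_def by (rule isotropic_frame_scaled)
  interpret P: prob_space ?P by (rule prob_space_PiM) (rule prob_space_\<nu>)
  have "\<theta> * (1 - \<delta>) - (1 - exp (- \<theta> * R)) / R = - c_delta \<delta> / R"
  proof -
    have "- \<theta> * R = ln (1 - \<delta>)" using R by (simp add: \<theta>_def)
    then have "1 - exp (- \<theta> * R) = \<delta>" using \<delta> by simp
    then show ?thesis
      by (simp add: \<theta>_def c_delta_def add_divide_distrib diff_divide_distrib mult.commute)
  qed
  then have "measure ?P {xs \<in> space ?P. \<not> 1 - \<delta> \<le> lambda_min (gram_w m \<phi> n w xs)}
      \<le> real m * exp (- c_delta \<delta> / R)"
    using F.measure_lambda_min_less[OF m \<theta>, of "1 - \<delta>"]
    by (simp add: gram_w_eq_frame_gram[where w = w, OF w_pos])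
  also have "\<dots> \<le> real m * exp (- ln (real m / \<eta>))"
  proof -
    \<comment> \<open>With R = m / (\<alpha> n) this is the lower bound on \<open>n\<close>,
      rearranged.\<close>
    have "ln (real m / \<eta>) \<le> c_delta \<delta> / R"
    proof -
      have "R * ln (real m / \<eta>) / c_delta \<delta>
          = (1 / c_delta \<delta>) * (1 / \<alpha>) * real m * ln (real m / \<eta>) / real n"
        by (simp add: R_def)
      also have "\<dots> \<le> real n / real n" by (rule divide_right_mono[OF large]) simp
      also have "\<dots> = 1" using n by simp
      finally show ?thesis
        using R c_delta_pos[OF \<delta>] by (simp add: pos_le_divide_eq pos_divide_le_eq mult.commute)
    qed
    then have "- c_delta \<delta> / R \<le> - ln (real m / \<eta>)" by (simp only: minus_divide_left neg_le_iff_le)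
    then show ?thesis by (intro mult_left_mono iffD2[OF exp_le_cancel_iff]) simp_all
  qed
  also have "\<dots> = \<eta>" using m \<eta> by (simp add: exp_minus)
  finally show ?thesis
    using P.prob_neg[OF sets_good_gram[of "1 - \<delta>"]] by simp
qed

lemma coercive_least_squaresI:
  assumes "0 < \<gamma>" and "\<gamma> \<le> lambda_min (gram_w m \<phi> n w xs)"
  shows "coercive_least_squares m n \<phi> w xs \<gamma>"
proof
  show "\<gamma> * dot m v v \<le> dot m v (mv m (frame_gram (\<lambda>i. scaled n w (\<phi> i)) n xs) v)" for v
    using assms(2) lambda_min_ge_iff[OF sym_frame_gram m, of \<gamma> "\<lambda>i. scaled n w (\<phi> i)" n xs]
    unfolding gram_w_eq_frame_gram[where w = w, OF w_pos] by blast
qed (rule w_pos assms(1))+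

text \<open>Split the error at g, the combination given by \<open>c\<close>. The part between g and
  the projection lies in the space, so Parseval turns its norm into a coefficient distance; w >= (1
  - \<alpha>) h at the sample points bounds the empirical norm of f - g by K / sqrt (1 -
  \<alpha>).\<close>

lemma wls_error_le:
  assumes f: "f \<in> borel_measurable M" "integrable M (\<lambda>x. (f x)\<^sup>2)"
    and \<delta>: "0 < \<delta>" "\<delta> < 1"
    and good: "1 - \<delta> \<le> lambda_min (gram_w m \<phi> n w xs)"
    and K: "0 \<le> K" "\<And>l. l < n \<Longrightarrow> (f (xs l) - basis_comb m \<phi> c (xs l))\<^sup>2 \<le> K\<^sup>2 * h (xs l)"
  shows "L2norm M (\<lambda>x. f x - wls_proj m \<phi> n w xs f x)
    \<le> L2norm M (\<lambda>x. f x - basis_comb m \<phi> c x) + (1 - \<delta>) powr (-1/2) * (1 - \<alpha>) powr (-1/2) * K"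
proof -
  interpret coercive_least_squares m n \<phi> w xs "1 - \<delta>"
    using \<delta> good by (intro coercive_least_squaresI) auto
  obtain b where b: "wls_proj m \<phi> n w xs f = basis_comb m \<phi> b"
    and gap: "(1 - \<delta>) * dot m (\<lambda>i. c i - b i) (\<lambda>i. c i - b i)
      \<le> (empnorm n w xs (\<lambda>x. f x - basis_comb m \<phi> c x))\<^sup>2"
    using wls_proj_exists by blast
  define d where "d = (\<lambda>i. c i - b i)"
  have "(empnorm n w xs (\<lambda>x. f x - basis_comb m \<phi> c x))\<^sup>2
      = (1 / real n) * (\<Sum>k<n. (f (xs k) - basis_comb m \<phi> c (xs k))\<^sup>2 / w (xs k))"
    unfolding empnorm_def using less_imp_le[OF w_pos]
    by (intro real_sqrt_pow2 mult_nonneg_nonneg sum_nonneg divide_nonneg_nonneg) auto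
  also have "\<dots> \<le> (1 / real n) * (\<Sum>k<n. K\<^sup>2 / (1 - \<alpha>))"
  proof (intro mult_left_mono sum_mono)
    fix k assume "k \<in> {..<n}"
    then have "(f (xs k) - basis_comb m \<phi> c (xs k))\<^sup>2 / w (xs k) \<le> K\<^sup>2 * h (xs k) / w (xs k)"
      using K(2) less_imp_le[OF w_pos] by (intro divide_right_mono) auto
    also have "\<dots> \<le> K\<^sup>2 / (1 - \<alpha>)"
      using mult_left_mono[OF w_ge_h[of "xs k"], of "K\<^sup>2"] w_pos[of "xs k"] \<alpha> by (simp add: field_simps)
    finally show "(f (xs k) - basis_comb m \<phi> c (xs k))\<^sup>2 / w (xs k) \<le> K\<^sup>2 / (1 - \<alpha>)" .
  qed simp
  also have "\<dots> = K\<^sup>2 / (1 - \<alpha>)" using n by simp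
  finally have "(1 - \<delta>) * dot m d d \<le> K\<^sup>2 / (1 - \<alpha>)" using gap by (simp add: d_def)
  then have "dot m d d \<le> K\<^sup>2 / (1 - \<alpha>) / (1 - \<delta>)"
    using \<delta> by (subst pos_le_divide_eq) (simp_all add: mult.commute)
  then have "dot m d d \<le> K\<^sup>2 / ((1 - \<delta>) * (1 - \<alpha>))" by (simp add: mult.commute)
  then have "sqrt (dot m d d) \<le> sqrt (K\<^sup>2 / ((1 - \<delta>) * (1 - \<alpha>)))" by simp
  also have "\<dots> = (1 - \<delta>) powr (-1/2) * (1 - \<alpha>) powr (-1/2) * K"
    using K(1) \<delta> \<alpha> by (simp add: real_sqrt_divide real_sqrt_mult powr_minus_divide powr_half_sqrt)
  finally have *: "L2norm M (basis_comb m \<phi> d) \<le> (1 - \<delta>) powr (-1/2) * (1 - \<alpha>) powr (-1/2) * K"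
    by (simp add: orthonormal_comb(3)[OF ONB])
  have int: "integrable M (\<lambda>x. (f x - basis_comb m \<phi> c x)\<^sup>2)"
  proof -
    have "integrable M (\<lambda>x. (f x)\<^sup>2 - 2 * (f x * basis_comb m \<phi> c x) + (basis_comb m \<phi> c x)\<^sup>2)"
      using f orthonormal_comb[OF ONB, of c]
        integrable_mult_of_squares[OF f orthonormal_comb(1,2)[OF ONB, of c]] by simp
    then show ?thesis by (simp add: power2_diff algebra_simps)
  qed
  have "L2norm M (\<lambda>x. (f x - basis_comb m \<phi> c x) + basis_comb m \<phi> d x)
      \<le> L2norm M (\<lambda>x. f x - basis_comb m \<phi> c x) + L2norm M (basis_comb m \<phi> d)"
    using f(1) orthonormal_comb(1)[OF ONB, of c]
    by (intro L2norm_triangle int orthonormal_comb[OF ONB] borel_measurable_diff)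
  moreover have "(f x - basis_comb m \<phi> c x) + basis_comb m \<phi> d x = f x - basis_comb m \<phi> b x" for x
    by (simp add: basis_comb_def d_def left_diff_distrib sum_subtractf)
  ultimately show ?thesis using * by (simp add: b)
qed

end

section \<open>From single approximants to the infimum\<close>

lemma normed_fun_space_nonneg: "normed_fun_space H nH \<Longrightarrow> g \<in> H \<Longrightarrow> 0 \<le> nH g"
  unfolding normed_fun_space_def by blast

text \<open>The zero function lies in the space and \<open>f\<close> in \<open>H\<close>, so the
  infimum is a real number; near-minimisers lie in \<open>H\<close> because \<open>Hnorm_ext\<close>
  is infinite elsewhere.\<close>

lemma minimizing_sequence:
  assumes H: "normed_fun_space H nH" and f: "f \<in> H"
  obtains r c where "(INF g\<in>Vm m \<phi>. Hnorm_ext H nH (\<lambda>x. f x - g x)) = ereal r"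
    and "\<And>k. (\<lambda>x. f x - basis_comb m \<phi> (c k) x) \<in> H"
    and "(\<lambda>k. nH (\<lambda>x. f x - basis_comb m \<phi> (c k) x)) \<longlonglongrightarrow> r"
proof -
  define I where "I = (INF g\<in>Vm m \<phi>. Hnorm_ext H nH (\<lambda>x. f x - g x))"
  have "(\<lambda>x. 0) \<in> Vm m \<phi>" by (auto simp: Vm_def intro!: exI[of _ "\<lambda>_. 0"])
  then have "I \<le> ereal (nH f)" unfolding I_def by (rule INF_lower2) (simp add: Hnorm_ext_def f)
  moreover have "0 \<le> I"
    unfolding I_def by (intro INF_greatest) (simp add: Hnorm_ext_def normed_fun_space_nonneg[OF H])
  ultimately obtain r where r: "I = ereal r" by (cases I) auto
  have "\<exists>c. (\<lambda>x. f x - basis_comb m \<phi> c x) \<in> H \<and>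
      nH (\<lambda>x. f x - basis_comb m \<phi> c x) < r + 1 / real (Suc k)" for k
  proof -
    have "I < ereal (r + 1 / real (Suc k))" by (simp add: r)
    then obtain g where g: "g \<in> Vm m \<phi>" "Hnorm_ext H nH (\<lambda>x. f x - g x) < ereal (r + 1 / real (Suc k))"
      unfolding I_def INF_less_iff by blast
    then show ?thesis by (auto simp: Vm_eq Hnorm_ext_def split: if_splits)
  qed
  then obtain c where c: "\<And>k. (\<lambda>x. f x - basis_comb m \<phi> (c k) x) \<in> H"
    "\<And>k. nH (\<lambda>x. f x - basis_comb m \<phi> (c k) x) < r + 1 / real (Suc k)" by metis
  have lower: "r \<le> nH (\<lambda>x. f x - basis_comb m \<phi> (c k) x)" for k
  proof -
    have "I \<le> Hnorm_ext H nH (\<lambda>x. f x - basis_comb m \<phi> (c k) x)"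
      unfolding I_def by (rule INF_lower) (simp add: Vm_eq)
    with r c(1) show ?thesis by (simp add: Hnorm_ext_def)
  qed
  have upper: "(\<lambda>k. r + 1 / real (Suc k)) \<longlonglongrightarrow> r"
    using LIMSEQ_inverse_real_of_nat_add[of r] unfolding inverse_eq_divide .
  have "(\<lambda>k. nH (\<lambda>x. f x - basis_comb m \<phi> (c k) x)) \<longlonglongrightarrow> r"
    by (rule tendsto_sandwich[OF always_eventually always_eventually tendsto_const upper])
      (use lower less_imp_le[OF c(2)] in blast)+
  with that r c(1) show ?thesis unfolding I_def by blast
qed

theorem mainTheorem6:
  fixes M :: "'a::polish_space measure"
    and m n :: nat
    and \<phi> :: "nat \<Rightarrow> 'a \<Rightarrow> real"
    and H :: "('a \<Rightarrow> real) set"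
    and nH :: "('a \<Rightarrow> real) \<Rightarrow> real"
    and C_H :: real
    and h f :: "'a \<Rightarrow> real"
    and \<alpha> \<delta> \<eta> :: real
  assumes M_borel: "sets M = sets borel"
    and M_prob: "prob_space M"
    and m_pos: "m \<ge> 1"
    and ONB: "orthonormal_L2 M m \<phi>"
    and H_space: "normed_fun_space H nH"
    and H_L2: "\<forall>g\<in>H. g \<in> borel_measurable M \<and> integrable M (\<lambda>x. (g x)^2)"
    and H_emb1: "\<forall>g\<in>H. L2norm M g \<le> C_H * nH g"
    and H_emb2: "\<forall>g\<in>H. esssup M (\<lambda>x. ereal (h x powr (-1/2) * \<bar>g x\<bar>)) \<le> ereal (nH g)"
    and h_meas: "h \<in> borel_measurable M"
    and h_pos: "\<forall>x. h x > 0"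
    and h_int: "integrable M h"
    and h_dens: "(\<integral>x. h x \<partial>M) = 1"
    and f_H: "f \<in> H"
    and \<alpha>: "0 < \<alpha>" "\<alpha> < 1"
    and \<delta>: "0 < \<delta>" "\<delta> < 1"
    and \<eta>: "0 < \<eta>" "\<eta> < 1"
    and n_large: "real n \<ge> (1 / c_delta \<delta>) * (1 / \<alpha>) * real m * ln (real m / \<eta>)"
  defines "P \<equiv> PiM {..<n} (\<lambda>_. density M (\<lambda>x. ennreal (\<alpha> * wm m \<phi> x + (1 - \<alpha>) * h x)))"
    and "S \<equiv> {xs \<in> space (PiM {..<n} (\<lambda>_. density M (\<lambda>x. ennreal (\<alpha> * wm m \<phi> x + (1 - \<alpha>) * h x)))). lambda_min (gram_w m \<phi> n (\<lambda>x. \<alpha> * wm m \<phi> x + (1 - \<alpha>) * h x) xs) \<ge> 1 - \<delta>}"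
  shows "measure P S \<ge> 1 - \<eta>
     \<and> (\<exists>A \<in> sets P. measure P A \<ge> 1 - \<eta> \<and>
          (\<forall>xs\<in>A. invertible_mat (gram_w m \<phi> n (\<lambda>x. \<alpha> * wm m \<phi> x + (1 - \<alpha>) * h x) xs) \<and>
             ereal (L2norm M (\<lambda>x. f x - wls_proj m \<phi> n (\<lambda>x. \<alpha> * wm m \<phi> x + (1 - \<alpha>) * h x) xs f x))
               \<le> ereal (C_H + (1 - \<delta>) powr (-1/2) * (1 - \<alpha>) powr (-1/2))
                  * (INF g\<in>Vm m \<phi>. Hnorm_ext H nH (\<lambda>x. f x - g x))))"
proof -
  interpret M: prob_space M by (rule M_prob)
  define w where "w = (\<lambda>x. \<alpha> * wm m \<phi> x + (1 - \<alpha>) * h x)"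
  \<comment> \<open>The quotient exceeds 1, so the lower bound on \<open>n\<close> is positive and
    rules out \<open>n = 0\<close>.\<close>
  have "0 < ln (real m / \<eta>)" using m_pos \<eta> by (intro ln_gt_zero) (simp add: field_simps)
  then have "0 < (1 / c_delta \<delta>) * (1 / \<alpha>) * real m * ln (real m / \<eta>)"
    using c_delta_pos[OF \<delta>] \<alpha> m_pos by simp
  with n_large have n_pos: "0 < n" by linarith
  interpret weighted_design M m n \<phi> h w \<alpha>
    by unfold_locales (use m_pos n_pos ONB h_meas h_pos h_int h_dens \<alpha> w_def in auto)
  have P: "P = PiM {..<n} (\<lambda>_. \<nu>)" by (simp add: P_def \<nu>_def) (simp add: w_def)
  have S: "S = {xs \<in> space P. 1 - \<delta> \<le> lambda_min (gram_w m \<phi> n w xs)}"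
    by (simp add: S_def P \<nu>_def) (simp add: w_def)
  have Sm: "S \<in> sets P" unfolding S P by (rule sets_good_gram)
  have PS: "1 - \<eta> \<le> measure P S"
    unfolding S P by (rule measure_good_gram[OF \<delta> \<eta>(1) n_large])
  obtain r c where inf: "(INF g\<in>Vm m \<phi>. Hnorm_ext H nH (\<lambda>x. f x - g x)) = ereal r"
    and cH: "\<And>k. (\<lambda>x. f x - basis_comb m \<phi> (c k) x) \<in> H"
    and lim: "(\<lambda>k. nH (\<lambda>x. f x - basis_comb m \<phi> (c k) x)) \<longlonglongrightarrow> r"
    by (rule minimizing_sequence[OF H_space f_H, of m \<phi>]) (rule that)
  define e where "e k x = f x - basis_comb m \<phi> (c k) x" for k x
  have eH: "e k \<in> H" for k unfolding e_def using cH .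
  have e0: "0 \<le> nH (e k)" for k by (rule normed_fun_space_nonneg[OF H_space eH])
  have bound: "AE x in M. (e k x)\<^sup>2 \<le> (nH (e k))\<^sup>2 * h x" for k
    using esssup_AE[of "\<lambda>x. ereal (h x powr (-1/2) * \<bar>e k x\<bar>)" M]
  proof eventually_elim
    case (elim x)
    have h0: "0 < h x" using h_pos by blast
    have "ereal (h x powr (-1/2) * \<bar>e k x\<bar>) \<le> ereal (nH (e k))"
      using elim H_emb2 eH by (meson order_trans)
    then have "\<bar>e k x\<bar> \<le> nH (e k) * sqrt (h x)"
      using h0 by (simp add: powr_minus_divide powr_half_sqrt field_simps)
    then have "\<bar>e k x\<bar>\<^sup>2 \<le> (nH (e k) * sqrt (h x))\<^sup>2" by (rule power_mono) simp
    then show ?case using h0 by (simp add: power_mult_distrib)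
  qed
  \<comment> \<open>\<open>\<nu>\<close> has a density with respect to \<open>M\<close>, so null
    sets of \<open>M\<close> stay null.\<close>
  have bound': "AE x in \<nu>. (e k x)\<^sup>2 \<le> (nH (e k))\<^sup>2 * h x" for k
  proof -
    have "(\<lambda>x. ennreal (w x)) \<in> borel_measurable M" using w_meas by measurable
    from AE_density[OF this] show ?thesis unfolding \<nu>_def using bound[of k] by auto
  qed
  have "AE xs in P. (e k (xs l))\<^sup>2 \<le> (nH (e k))\<^sup>2 * h (xs l)" if "l < n" for k l
    unfolding P by (rule AE_PiM_component) (use that prob_space_\<nu> bound' in auto)
  \<comment> \<open>Countably many \<open>k\<close> and finitely many \<open>l\<close> share one
    null set.\<close>
  then have "AE xs in P. \<forall>k. \<forall>l\<in>{..<n}. (e k (xs l))\<^sup>2 \<le> (nH (e k))\<^sup>2 * h (xs l)"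
    by (subst AE_all_countable, intro allI AE_finite_allI) auto
  \<comment> \<open>Passing to a measurable null set \<open>N\<close> makes \<open>S - N\<close> a
    legitimate event.\<close>
  then obtain N where N: "N \<in> null_sets P"
    "{xs \<in> space P. \<not> (\<forall>k. \<forall>l\<in>{..<n}. (e k (xs l))\<^sup>2 \<le> (nH (e k))\<^sup>2 * h (xs l))} \<subseteq> N"
    by (auto simp: eventually_ae_filter)
  define s where "s = (1 - \<delta>) powr (-1/2) * (1 - \<alpha>) powr (-1/2)"
  have err: "invertible_mat (gram_w m \<phi> n w xs) \<and>
      L2norm M (\<lambda>x. f x - wls_proj m \<phi> n w xs f x) \<le> (C_H + s) * r" if xs: "xs \<in> S - N" for xs
  proof
    have good: "1 - \<delta> \<le> lambda_min (gram_w m \<phi> n w xs)" and xsP: "xs \<in> space P" using xs by (auto simp: S)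
    interpret coercive_least_squares m n \<phi> w xs "1 - \<delta>"
      using \<delta> good by (intro coercive_least_squaresI) auto
    show "invertible_mat (gram_w m \<phi> n w xs)" by (rule invertible_gram)
    have "L2norm M (\<lambda>x. f x - wls_proj m \<phi> n w xs f x) \<le> (C_H + s) * nH (e k)" for k
    proof -
      have "(e k (xs l))\<^sup>2 \<le> (nH (e k))\<^sup>2 * h (xs l)" if "l < n" for l
        using N(2) xs xsP that by blast
      \<comment> \<open>The general bound is applied with \<open>K\<close> equal to
        \<open>nH (e k)\<close>.\<close>
      then have "L2norm M (\<lambda>x. f x - wls_proj m \<phi> n w xs f x) \<le> L2norm M (e k) + s * nH (e k)"
        unfolding s_def e_def
        by (intro wls_error_le[OF _ _ \<delta> good]) (use f_H H_L2 e0[of k] in \<open>auto simp: e_def[abs_def]\<close>)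
      also have "\<dots> \<le> C_H * nH (e k) + s * nH (e k)" using H_emb1 eH by simp
      finally show ?thesis by (simp add: algebra_simps)
    qed
    \<comment> \<open>The error does not depend on \<open>k\<close>, so the bound passes to the
      limit.\<close>
    moreover have "(\<lambda>k. (C_H + s) * nH (e k)) \<longlonglongrightarrow> (C_H + s) * r"
      unfolding e_def by (intro tendsto_intros lim)
    ultimately show "L2norm M (\<lambda>x. f x - wls_proj m \<phi> n w xs f x) \<le> (C_H + s) * r"
      by (intro LIMSEQ_le_const) auto
  qed
  \<comment> \<open>Removing \<open>N\<close> costs no probability, so the good event serves both
    claims.\<close>
  have "measure P (S - N) = measure P S" using Sm N(1) by (rule measure_Diff_null_set)
  moreover have "S - N \<in> sets P" using Sm N(1) by auto
  ultimately show ?thesis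
    using PS err unfolding inf w_def[symmetric] s_def
    by (intro conjI bexI[of _ "S - N"]) auto
qed

end
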